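(* Let $\mathcal U=\mathcal U^{(3)}=\bigoplus_{s\in\mathbb Z}V_{3s}$ be the vertex operator superalgebra extending $V_{-1}(\mathfrak{sl}(3))$. Then $y=\mathrm{sch}[\mathcal U](\tau)$ satisfies the fifth order modular linear differential equation $$\theta^5(y)-\frac7{36}E_4(\tau)\theta^3(y)+\frac{19}{216}E_6(\tau)\theta^2(y)-\frac5{324}E_4(\tau)^2\theta(y)+\frac5{1944}E_4(\tau)E_6(\tau)\,y=0.$$
   Context: $q=e^{2\pi i\tau}$; $\theta_k:=q\frac{d}{dq}-\frac{k}{12}E_2(\tau)$ and the iterated Ramanujan–Serre derivative is $\theta^n:=\theta_{2n-2}\circ\cdots\circ\theta_2\circ\theta_0$. $E_2=1-24\sum_{n\ge1}\frac{nq^n}{1-q^n}$, $E_4=1+240\sum_{n\ge1}\frac{n^3q^n}{1-q^n}$, $E_6=1-504\sum_{n\ge1}\frac{n^5q^n}{1-q^n}$. $V_{-1}(\mathfrak{sl}(3))$ is the simple affine vertex algebra at level $-1$ (central charge $c=-4$); for $s\ge0$, $V_s=L_{\mathfrak{sl}(3)}(-(1+s)\Lambda_0+s\Lambda_1)$, $V_{-s}=L_{\mathfrak{sl}(3)}(-(1+s)\Lambda_0+s\Lambda_2)$. In $\mathcal U$ the summand $V_{3s}$ has parity $s$ mod 2, and $\mathrm{sch}[\mathcal U](\tau)=\sum_{s\in\mathbb Z}(-1)^s\,\mathrm{tr}_{V_{3s}}q^{L(0)-c/24}$. Explicitly, $\mathrm{sch}[\mathcal U](\tau)=-\frac18\left(E_2(\tau)-9E_2(3\tau)\right)\frac{\eta(3\tau)^3}{\eta(\tau)^5}$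 with $\eta(\tau)=q^{1/24}\prod_{i\ge1}(1-q^i)$. *)

theory Defs
  imports "HOL-Analysis.Analysis"
begin

text \<open>
  All functions below are functions of \<open>\<tau>\<close>, meaningful for \<open>Im \<tau> > 0\<close>, with \<open>q = e\<^sup>2\<^sup>\<pi>\<^sup>i\<^sup>\<tau>\<close>.
\<close>

definition nome :: "complex \<Rightarrow> complex" where
  "nome \<tau> = exp (2 * of_real pi * \<i> * \<tau>)"

definition E2 :: "complex \<Rightarrow> complex" where
  "E2 \<tau> = 1 - 24 * (\<Sum>n. of_nat (Suc n) * nome \<tau> ^ Suc n / (1 - nome \<tau> ^ Suc n))"

definition E4 :: "complex \<Rightarrow> complex" where
  "E4 \<tau> = 1 + 240 * (\<Sum>n. of_nat (Suc n) ^ 3 * nome \<tau> ^ Suc n / (1 - nome \<tau> ^ Suc n))"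

definition E6 :: "complex \<Rightarrow> complex" where
  "E6 \<tau> = 1 - 504 * (\<Sum>n. of_nat (Suc n) ^ 5 * nome \<tau> ^ Suc n / (1 - nome \<tau> ^ Suc n))"

text \<open>The factor \<open>q\<^sup>1\<^sup>/\<^sup>2\<^sup>4\<close> is \<open>e\<^sup>2\<^sup>\<pi>\<^sup>i\<^sup>\<tau>\<^sup>/\<^sup>2\<^sup>4\<close>, not a principal power of \<open>q\<close>.\<close>

definition dedekind_eta :: "complex \<Rightarrow> complex" where
  "dedekind_eta \<tau> = exp (2 * of_real pi * \<i> * \<tau> / 24) * (\<Prod>i. 1 - nome \<tau> ^ Suc i)"

text \<open>
  Since \<open>q = e\<^sup>2\<^sup>\<pi>\<^sup>i\<^sup>\<tau>\<close>, the operator \<open>q d/dq\<close> is \<open>(2\<pi>i)\<^sup>-\<^sup>1 d/d\<tau>\<close>; this also applies to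
  series in fractional powers of \<open>q\<close>.
\<close>

definition q_deriv :: "(complex \<Rightarrow> complex) \<Rightarrow> complex \<Rightarrow> complex" where
  "q_deriv f \<tau> = deriv f \<tau> / (2 * of_real pi * \<i>)"

definition serre_deriv :: "nat \<Rightarrow> (complex \<Rightarrow> complex) \<Rightarrow> complex \<Rightarrow> complex" where
  "serre_deriv k f \<tau> = q_deriv f \<tau> - of_nat k / 12 * E2 \<tau> * f \<tau>"

text \<open>\<open>\<theta>\<^sup>n = \<theta>\<^bsub>2n-2\<^esub> \<circ> \<dots> \<circ> \<theta>\<^sub>2 \<circ> \<theta>\<^sub>0\<close>, where \<open>\<theta>\<^sub>k\<close> is \<open>serre_deriv k\<close>.\<close>

primrec serre_deriv_iter :: "nat \<Rightarrow> (complex \<Rightarrow> complex) \<Rightarrow> complex \<Rightarrow> complex" where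
  "serre_deriv_iter 0 f = f"
| "serre_deriv_iter (Suc n) f = serre_deriv (2 * n) (serre_deriv_iter n f)"

text \<open>
  The supercharacter \<open>\<Sum>s\<in>\<int>. (-1)\<^sup>s tr q\<^bsup>L(0)-c/24\<^esup>\<close> (trace over \<open>V\<^bsub>3s\<^esub>\<close>, \<open>c = -4\<close>) of the
  vertex operator superalgebra \<open>\<U> = \<Oplus>s\<in>\<int>. V\<^bsub>3s\<^esub>\<close> extending the simple affine vertex
  algebra of \<open>sl(3)\<close> at level \<open>-1\<close>. It is represented by its closed form as a function on the
  upper half plane; neither the modules \<open>V\<^bsub>3s\<^esub>\<close> nor their traces are constructed here.
\<close>

definition sch_U :: "complex \<Rightarrow> complex" where
  "sch_U \<tau> = - (1 / 8) * (E2 \<tau> - 9 * E2 (3 * \<tau>)) * (dedekind_eta (3 * \<tau>) ^ 3 / dedekind_eta \<tau> ^ 5)"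

end

theory Submission
  imports Defs
begin

text \<open>
  Let \<open>P, E\<^sub>4, E\<^sub>6\<close> be the Eisenstein series at \<open>\<tau>\<close>, let \<open>M = (3 E\<^sub>2(3\<tau>) - E\<^sub>2(\<tau>)) / 2\<close>
  and \<open>h = \<eta>(3\<tau>)\<^sup>3 / \<eta>(\<tau>)\<^sup>5\<close>, so that \<open>y = (P + 3M) h / 4\<close>. With \<open>D = q d/dq\<close>, besides
  Ramanujan's formulas for \<open>DP, DE\<^sub>4, DE\<^sub>6\<close>, one has \<open>Dh = (M/4 - P/12) h\<close> and
  \<open>DM = (2MP - 3M\<^sup>2 + E\<^sub>4) / 12\<close>, the latter because \<open>10 M\<^sup>2 = 9 E\<^sub>4(3\<tau>) + E\<^sub>4(\<tau>)\<close>. Hence every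
  \<open>\<theta>\<^sup>n(y)\<close> has the form \<open>(P A + B) h\<close> with \<open>A, B\<close> polynomials in \<open>M, E\<^sub>4, E\<^sub>6\<close>, and the differential
  equation is a polynomial identity. All quadratic relations among Eisenstein series
  used here come from one rearrangement of double series in \<open>u\<^sub>n = q\<^sup>n / (1 - q\<^sup>n)\<close>,
  weighted by \<open>f(m - n)\<close> and \<open>f(m
      + n)\<close> where \<open>f\<close> is an even power or the indicator of the integers prime to 3.
\<close>

subsection \<open>Lambert coefficients and double series\<close>

definition lambert_coeff :: "complex \<Rightarrow> nat \<Rightarrow> complex" where
  "lambert_coeff q n = q ^ n / (1 - q ^ n)"

text \<open>A bound by a power of the product \<open>m * n\<close> lets the majorant of a double
  series split into two single series, which converge by the geometric decay of the Lambert
  coefficients. Only indices from 1 on are constrained, the range of every double sum below.\<close>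

definition poly_bounded :: "(nat \<Rightarrow> nat \<Rightarrow> complex) \<Rightarrow> bool" where
  "poly_bounded F \<longleftrightarrow> (\<exists>C p. \<forall>m\<ge>1. \<forall>n\<ge>1. norm (F m n) \<le> C * (real m * real n) ^ p)"

section \<open>Geometric decay of Lambert coefficients and absolute convergence\<close>

lemma one_minus_power_nonzero:
  fixes q :: complex
  assumes "norm q < 1" "n \<ge> 1"
  shows "1 - q ^ n \<noteq> 0"
proof
  assume "1 - q ^ n = 0"
  then have "norm q ^ n = 1" by (simp flip: norm_power)
  moreover have "norm q ^ n < 1" using assms by (simp add: power_less_one_iff)
  ultimately show False by simp
qed

text \<open>The denominator has norm at least \<open>1 - r\<close>, because
  \<open>norm q ^ n\<close> is at most \<open>norm q\<close>. Taking for \<open>r\<close> any upper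
  bound of \<open>norm q\<close> makes the estimate uniform in \<open>q\<close>, as the M-test on
  half planes requires.\<close>

lemma norm_lambert_coeff_le:
  assumes "norm q \<le> r" "r < 1" "n \<ge> 1"
  shows "norm (lambert_coeff q n) \<le> r ^ n / (1 - r)"
proof -
  have r0: "0 \<le> r" using assms(1) norm_ge_zero order_trans by blast
  have "norm q ^ n \<le> norm q ^ 1" using assms by (intro power_decreasing) auto
  then have "1 - r \<le> 1 - norm (q ^ n)" using assms by (simp add: norm_power)
  also have "\<dots> \<le> norm (1 - q ^ n)" using norm_triangle_ineq2[of 1 "q ^ n"] by simp
  finally have "1 - r \<le> norm (1 - q ^ n)" .
  moreover have "norm q ^ n \<le> r ^ n" using assms by (intro power_mono) auto
  ultimately show ?thesis using assms r0
    by (auto simp: lambert_coeff_def norm_divide norm_power intro!: frac_le)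
qed

text \<open>Termwise differentiation followed by multiplication by \<open>x\<close> raises the
  exponent by one, since \<open>diffs\<close> turns the coefficient \<open>n ^ p\<close> into
  \<open>(n + 1) ^ (p + 1)\<close>. The induction covers all \<open>x\<close> with
  \<open>norm x < 1\<close> because differentiation requires convergence around the point.\<close>

lemma summable_power_times_geometric:
  fixes r :: real
  assumes "0 \<le> r" "r < 1"
  shows "summable (\<lambda>n. real n ^ p * r ^ n)"
proof -
  have "summable (\<lambda>n. real n ^ p * x ^ n)" if "norm x < 1" for x :: real
    using that
  proof (induction p arbitrary: x)
    case 0
    then show ?case by (simp add: summable_geometric)
  next
    case (Suc p)
    have "summable (\<lambda>n. diffs (\<lambda>n. real n ^ p) n * x ^ n)"
      using Suc by (intro termdiff_converges[where K = 1]) auto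
    then have "summable (\<lambda>n. x * (diffs (\<lambda>n. real n ^ p) n * x ^ n))"
      by (rule summable_mult)
    then have "summable (\<lambda>n. real (Suc n) ^ Suc p * x ^ Suc n)"
      by (simp add: diffs_def mult_ac)
    then show ?case by (subst (asm) summable_Suc_iff)
  qed
  then show ?thesis using assms by auto
qed

lemma summable_on_majorant:
  fixes f :: "'a \<Rightarrow> complex"
  assumes "g summable_on A" "\<And>x. x \<in> A \<Longrightarrow> norm (f x) \<le> g x"
  shows "f summable_on A"
  by (rule abs_summable_summable, rule Infinite_Sum.abs_summable_on_comparison_test'[OF assms])

lemma power_times_geometric_summable_on:
  fixes r :: real
  assumes "0 \<le> r" "r < 1"
  shows "(\<lambda>n. real n ^ p * r ^ n) summable_on A"
proof -
  have "(\<lambda>n. real n ^ p * r ^ n) summable_on UNIV"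
    using assms summable_power_times_geometric[OF assms]
    by (intro norm_summable_imp_summable_on) auto
  then show ?thesis by (rule summable_on_subset_banach) auto
qed

lemma pair_power_times_geometric_summable_on:
  fixes r :: real
  assumes "0 \<le> r" "r < 1"
  shows "(\<lambda>(m, n). C * (real m * real n) ^ p * (r ^ m * r ^ n)) summable_on A"
proof -
  define g where "g n = real n ^ p * r ^ n" for n
  have g: "g summable_on UNIV"
    unfolding g_def by (rule power_times_geometric_summable_on[OF assms])
  have "(\<lambda>(m, n). g m * g n) summable_on (UNIV \<times> UNIV)"
  proof (rule summable_on_SigmaI)
    show "((\<lambda>n. case (m, n) of (m, n) \<Rightarrow> g m * g n) has_sum g m * infsum g UNIV) UNIV" for m
      using has_sum_cmult_right[OF has_sum_infsum[OF g]] by simp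
    show "(\<lambda>m. g m * infsum g UNIV) summable_on UNIV"
      using g by (rule summable_on_cmult_left)
  qed (use assms in \<open>auto simp: g_def\<close>)
  then have "(\<lambda>x. C * (case x of (m, n) \<Rightarrow> g m * g n)) summable_on UNIV"
    by (intro summable_on_cmult_right) simp
  then have "(\<lambda>(m, n). C * (real m * real n) ^ p * (r ^ m * r ^ n)) summable_on UNIV"
    by (rule summable_on_cong[THEN iffD1, rotated]) (auto simp: g_def power_mult_distrib)
  then show ?thesis by (rule summable_on_subset_banach) auto
qed

lemma lambert_pair_summable_on:
  assumes "norm q < 1" "poly_bounded F"
  shows "(\<lambda>(m, n). F m n * (lambert_coeff q m * lambert_coeff q n)) summable_on {1..} \<times> {1..}"
    and "(\<lambda>(m, n). F m n * lambert_coeff q (m + n)) summable_on {1..} \<times> {1..}"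
proof -
  define r where "r = norm q"
  have r: "0 \<le> r" "r < 1" using assms by (auto simp: r_def)
  obtain C p where C: "\<And>m n. m \<ge> 1 \<Longrightarrow> n \<ge> 1 \<Longrightarrow> norm (F m n) \<le> C * (real m * real n) ^ p"
    using assms(2) unfolding poly_bounded_def by blast
  have u: "norm (lambert_coeff q n) \<le> r ^ n / (1 - r)" if "n \<ge> 1" for n
    using norm_lambert_coeff_le[of q r n] that r by (simp add: r_def)
  have C0: "0 \<le> C * (real m * real n) ^ p" if "m \<ge> 1" "n \<ge> 1" for m n
    using C[OF that] norm_ge_zero order_trans by blast
  show "(\<lambda>(m, n). F m n * (lambert_coeff q m * lambert_coeff q n)) summable_on {1..} \<times> {1..}"
  proof (rule summable_on_majorant[OF
      pair_power_times_geometric_summable_on[OF r, where C = "C / (1 - r)\<^sup>2" and p = p]], clarsimp)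
    fix m n :: nat assume mn: "Suc 0 \<le> m" "Suc 0 \<le> n"
    have "norm (F m n) * (norm (lambert_coeff q m) * norm (lambert_coeff q n))
        \<le> (C * (real m * real n) ^ p) * ((r ^ m / (1 - r)) * (r ^ n / (1 - r)))"
      using mn r u C C0 by (intro mult_mono) auto
    then show "norm (F m n * (lambert_coeff q m * lambert_coeff q n))
        \<le> C * (real m * real n) ^ p * (r ^ m * r ^ n) / (1 - r)\<^sup>2"
      by (simp add: norm_mult power2_eq_square)
  qed
  show "(\<lambda>(m, n). F m n * lambert_coeff q (m + n)) summable_on {1..} \<times> {1..}"
  proof (rule summable_on_majorant[OF
      pair_power_times_geometric_summable_on[OF r, where C = "C / (1 - r)" and p = p]], clarsimp)
    fix m n :: nat assume mn: "Suc 0 \<le> m" "Suc 0 \<le> n"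
    have "norm (F m n) * norm (lambert_coeff q (m + n))
        \<le> (C * (real m * real n) ^ p) * (r ^ (m + n) / (1 - r))"
      using mn r u[of "m + n"] C C0 by (intro mult_mono) auto
    then show "norm (F m n * lambert_coeff q (m + n))
        \<le> C * (real m * real n) ^ p * (r ^ m * r ^ n) / (1 - r)"
      by (simp add: norm_mult power_add)
  qed
qed

lemma lambert_summable_on:
  assumes "norm q < 1"
  shows "(\<lambda>n. of_nat n ^ p * lambert_coeff q n) summable_on {1..}"
    and "(\<lambda>n. of_nat n ^ p * lambert_coeff q n ^ 2) summable_on {1..}"
proof -
  define r where "r = norm q"
  have r: "0 \<le> r" "r < 1" using assms by (auto simp: r_def)
  have u: "norm (lambert_coeff q n) \<le> r ^ n / (1 - r)" if "n \<ge> 1" for n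
    using norm_lambert_coeff_le[of q r n] that r by (simp add: r_def)
  have s: "(\<lambda>n. c * (real n ^ p * r ^ n)) summable_on {1..}" for c
    by (intro summable_on_cmult_right power_times_geometric_summable_on r)
  show "(\<lambda>n. of_nat n ^ p * lambert_coeff q n) summable_on {1..}"
  proof (rule summable_on_majorant[OF s[of "1 / (1 - r)"]])
    fix n :: nat assume "n \<in> {1..}"
    then show "norm (of_nat n ^ p * lambert_coeff q n) \<le> 1 / (1 - r) * (real n ^ p * r ^ n)"
      using u[of n] mult_left_mono[OF u[of n], of "real n ^ p"] by (simp add: norm_mult norm_power)
  qed
  show "(\<lambda>n. of_nat n ^ p * lambert_coeff q n ^ 2) summable_on {1..}"
  proof (rule summable_on_majorant[OF s[of "1 / (1 - r)^2"]])
    fix n :: nat assume "n \<in> {1..}"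
    then have n: "n \<ge> 1" by simp
    have "r ^ n \<le> 1" using r by (simp add: power_le_one)
    then have "r ^ n / (1 - r) \<le> 1 / (1 - r)" using r by (intro divide_right_mono) auto
    then have "norm (lambert_coeff q n) ^ 2 \<le> (r ^ n / (1 - r)) * (1 / (1 - r))"
      unfolding power2_eq_square using u[OF n] r by (intro mult_mono) auto
    then have "norm (lambert_coeff q n) ^ 2 \<le> r ^ n / (1 - r) ^ 2"
      by (simp add: power2_eq_square)
    then show "norm (of_nat n ^ p * lambert_coeff q n ^ 2) \<le> 1 / (1 - r)^2 * (real n ^ p * r ^ n)"
      using mult_left_mono[of _ _ "real n ^ p"] by (fastforce simp: norm_mult norm_power)
  qed
qed

section \<open>Weights of polynomial growth\<close>

lemma poly_boundedI:
  assumes "\<And>m n. m \<ge> 1 \<Longrightarrow> n \<ge> 1 \<Longrightarrow> norm (F m n) \<le> C * (real m * real n) ^ p"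
  shows "poly_bounded F"
  using assms unfolding poly_bounded_def by blast

lemma poly_boundedE:
  assumes "poly_bounded F"
  obtains C p where "C \<ge> 0" "\<And>m n. m \<ge> 1 \<Longrightarrow> n \<ge> 1 \<Longrightarrow> norm (F m n) \<le> C * (real m * real n) ^ p"
proof -
  from assms obtain C p where C: "\<And>m n. m \<ge> 1 \<Longrightarrow> n \<ge> 1 \<Longrightarrow> norm (F m n) \<le> C * (real m * real n) ^ p"
    unfolding poly_bounded_def by blast
  have "0 \<le> C" using order_trans[OF norm_ge_zero C[of 1 1]] by simp
  with C show ?thesis using that by blast
qed

text \<open>This and the next two lemmas treat the weights into which \<open>W\<close> and
  \<open>V\<close> turn in the bilinear part \<open>Z\<close> of
  \<open>lambert_pair_sum_regroup\<close>. Here \<open>k + l\<close> is at most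
  \<open>2 * k * l\<close>, which costs a doubling of the exponent.\<close>

lemma poly_bounded_shift:
  assumes "poly_bounded F"
  shows "poly_bounded (\<lambda>k l. F l (k + l))"
proof -
  obtain C p where C: "C \<ge> 0" "\<And>m n. m \<ge> 1 \<Longrightarrow> n \<ge> 1 \<Longrightarrow> norm (F m n) \<le> C * (real m * real n) ^ p"
    using poly_boundedE[OF assms] by blast
  show ?thesis
  proof (rule poly_boundedI)
    fix k l :: nat assume kl: "k \<ge> 1" "l \<ge> 1"
    have "1 \<le> real k" "1 \<le> real l" using kl by auto
    then have "1 * real l \<le> real k * real l" "real k * 1 \<le> real k * real l"
      by (intro mult_mono; simp)+
    then have "real (k + l) \<le> 2 * (real k * real l)" by simp
    then have "real l * real (k + l) \<le> real l * real k * (2 * (real k * real l))"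
      using kl by (intro mult_mono) auto
    then have "(real l * real (k + l)) ^ p \<le> (2 * (real k * real l) ^ 2) ^ p"
      by (intro power_mono) (auto simp: power2_eq_square mult_ac)
    then have "C * (real l * real (k + l)) ^ p \<le> C * 2 ^ p * (real k * real l) ^ (2 * p)"
      using C(1) mult_left_mono by (fastforce simp: power_mult_distrib power_mult)
    then show "norm (F l (k + l)) \<le> C * 2 ^ p * (real k * real l) ^ (2 * p)"
      using C(2)[of l "k + l"] kl by linarith
  qed
qed

lemma poly_bounded_diff1:
  assumes "poly_bounded F"
  shows "poly_bounded (\<lambda>k l. if k < l then F (l - k) l else 0)"
proof -
  obtain C p where C: "C \<ge> 0" "\<And>m n. m \<ge> 1 \<Longrightarrow> n \<ge> 1 \<Longrightarrow> norm (F m n) \<le> C * (real m * real n) ^ p"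
    using poly_boundedE[OF assms] by blast
  show ?thesis
  proof (rule poly_boundedI)
    fix k l :: nat assume kl: "k \<ge> 1" "l \<ge> 1"
    show "norm (if k < l then F (l - k) l else 0) \<le> C * (real k * real l) ^ (2 * p)"
    proof (cases "k < l")
      case True
      have "real l \<le> real k * real l" using kl mult_right_mono[of 1 "real k" "real l"] by simp
      then have "real (l - k) \<le> real k * real l" by linarith
      with \<open>real l \<le> real k * real l\<close> have "real (l - k) * real l \<le> (real k * real l) * (real k
      * real l)"
        using True by (intro mult_mono) auto
      then have "(real (l - k) * real l) ^ p \<le> ((real k * real l)\<^sup>2) ^ p"
        by (intro power_mono) (auto simp: power2_eq_square)
      then have "C * (real (l - k) * real l) ^ p \<le> C * (real k * real l) ^ (2 * p)"
        using C(1) by (auto simp: power_mult intro!: mult_left_mono)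
      moreover have "norm (F (l - k) l) \<le> C * (real (l - k) * real l) ^ p"
        using True kl by (intro C(2)) auto
      ultimately show ?thesis using True by simp
    qed (use C(1) in auto)
  qed
qed

lemma poly_bounded_diff2:
  assumes "poly_bounded F"
  shows "poly_bounded (\<lambda>k l. if l < k then F l (k - l) else 0)"
proof -
  obtain C p where C: "C \<ge> 0" "\<And>m n. m \<ge> 1 \<Longrightarrow> n \<ge> 1 \<Longrightarrow> norm (F m n) \<le> C * (real m * real n) ^ p"
    using poly_boundedE[OF assms] by blast
  show ?thesis
  proof (rule poly_boundedI)
    fix k l :: nat assume kl: "k \<ge> 1" "l \<ge> 1"
    show "norm (if l < k then F l (k - l) else 0) \<le> C * (real k * real l) ^ p"
    proof (cases "l < k")
      case True
      have "C * (real l * real (k - l)) ^ p \<le> C * (real k * real l) ^ p"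
        using C(1) True kl by (intro mult_left_mono power_mono) (auto simp: mult.commute)
      moreover have "norm (F l (k - l)) \<le> C * (real l * real (k - l)) ^ p"
        using True kl by (intro C(2)) auto
      ultimately show ?thesis using True by simp
    qed (use C(1) in auto)
  qed
qed

section \<open>Regrouping of double Lambert series\<close>

lemma has_sum_subtract:
  fixes f g :: "'a \<Rightarrow> 'b :: real_normed_algebra_1"
  assumes "(f has_sum a) A" "(g has_sum b) A"
  shows "((\<lambda>x. f x - g x) has_sum (a - b)) A"
  using has_sum_add[OF assms(1) has_sum_uminusI[OF assms(2)]] by simp

text \<open>Summation along \<open>n = k + l\<close>: for fixed \<open>n\<close> the index
  \<open>l\<close> runs from 1 to \<open>n - 1\<close>, so \<open>n = 1\<close> contributes an empty
  sum.\<close>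

lemma has_sum_pairs_triangle:
  fixes h :: "nat \<Rightarrow> nat \<Rightarrow> complex"
  assumes "((\<lambda>(k, l). h (k + l) l) has_sum s) ({1..} \<times> {1..})"
  shows "((\<lambda>n. \<Sum>l\<in>{1..<n}. h n l) has_sum s) {1..}"
proof -
  have "((\<lambda>(n, l). h n l) has_sum s) (SIGMA n:{1..}. {1..<n})"
    by (rule has_sum_reindex_bij_witness[where j = "\<lambda>(k, l). (k + l, l)" and i = "\<lambda>(n, l). (n
        - l, l)",
        THEN iffD1, OF _ _ _ _ _ refl assms]) auto
  then show ?thesis
    by (rule has_sum_SigmaD) (auto intro!: has_sum_finite)
qed

text \<open>The relation of the next lemma, solved for the product of the coefficients at
  \<open>l\<close> and \<open>k + l\<close>.\<close>

lemma lambert_coeff_mult_shift: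
  assumes "norm q < 1" "k \<ge> 1" "l \<ge> 1"
  shows "lambert_coeff q l * lambert_coeff q (k + l) =
         lambert_coeff q k * lambert_coeff q l - lambert_coeff q k * lambert_coeff q (k + l)
         - lambert_coeff q (k + l)"
  using one_minus_power_nonzero[OF assms(1), of k] one_minus_power_nonzero[OF assms(1), of l]
    one_minus_power_nonzero[OF assms(1), of "k + l"] assms(2,3)
  unfolding lambert_coeff_def by (simp add: divide_simps) (simp add: power_add algebra_simps)

text \<open>Write u_n for the coefficient at \<open>n\<close>. Then 1 + u_n = 1/(1 - q^n), so u_k
  u_l = q^(k+l) (1 + u_k)(1 + u_l), while 1 + u_k + u_l = (1 - q^(k+l)) (1 + u_k)(1 + u_l).\<close>

lemma lambert_coeff_mult_split:
  assumes "norm q < 1" "k \<ge> 1" "l \<ge> 1"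
  shows "lambert_coeff q k * lambert_coeff q l =
         lambert_coeff q (k + l) * (1 + lambert_coeff q k + lambert_coeff q l)"
  using one_minus_power_nonzero[OF assms(1), of k] one_minus_power_nonzero[OF assms(1), of l]
    one_minus_power_nonzero[OF assms(1), of "k + l"] assms(2,3)
  unfolding lambert_coeff_def by (simp add: divide_simps) (simp add: power_add algebra_simps)

text \<open>
  Off the diagonal, write the \<open>W\<close>-terms as \<open>u\<^sub>l u\<^bsub>k+l\<^esub>\<close> and the \<open>V\<close>-terms as \<open>u\<^sub>l u\<^bsub>k-l\<^esub>\<close>; the two
  preceding product formulas turn both into products with the factor \<open>u\<^sub>k\<close>. For suitable
  weights the bilinear part \<open>Z\<close> collapses to a diagonal sum or to a product of two series.
\<close>

proposition lambert_pair_sum_regroup: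
  fixes q :: complex and V W :: "nat \<Rightarrow> nat \<Rightarrow> complex"
  defines "u \<equiv> lambert_coeff q"
  assumes q: "norm q < 1"
    and W: "poly_bounded W" "\<And>m n. W m n = W n m"
    and V: "poly_bounded V" "\<And>m n. V m n = V n m"
  defines "Z \<equiv> (\<lambda>k l. 2 * (W l (k + l) - (if k < l then W (l - k) l else 0)
                            + (if l < k then V l (k - l) else 0)))"
  assumes lhs: "((\<lambda>(m, n). (W m n + V m n) * (u m * u n)) has_sum s) ({1..} \<times> {1..})"
    and rest: "((\<lambda>(k, l). Z k l * (u k * u l)) has_sum z) ({1..} \<times> {1..})"
  shows "((\<lambda>k. W k k * (u k)\<^sup>2 + u k * (\<Sum>l\<in>{1..<k}. V l (k - l) - 2 * W l k)) has_sum (s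
      - z)) {1..}"
proof -
  let ?X = "{1::nat..} \<times> {1::nat..}"
  note pair = lambert_pair_summable_on(1)[OF q, folded u_def]
  note pair_plus = lambert_pair_summable_on(2)[OF q, folded u_def]
  have "(\<lambda>(m, n). W m n * (u m * u n)) summable_on ?X" by (rule pair[OF W(1)])
  then obtain sW where sW: "((\<lambda>(m, n). W m n * (u m * u n)) has_sum sW) ?X"
    by (auto simp: summable_on_def)
  have "(\<lambda>(m, n). V m n * (u m * u n)) summable_on ?X" by (rule pair[OF V(1)])
  then obtain sV where sV: "((\<lambda>(m, n). V m n * (u m * u n)) has_sum sV) ?X"
    by (auto simp: summable_on_def)
  have s: "s = sW + sV"
    using has_sum_unique[OF lhs] has_sum_add[OF sW sV] by (auto simp: case_prod_unfold
        algebra_simps)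

  \<comment> \<open>The sums \<open>a\<close>, \<open>b\<close>, \<open>c\<close> are the three
    bilinear pieces of \<open>Z\<close>, without its factor 2; \<open>d\<close> and \<open>e\<close>
    are the linear terms that the two product formulas leave behind.\<close>
  have "(\<lambda>(k, l). W l (k + l) * (u k * u l)) summable_on ?X"
    by (rule pair[OF poly_bounded_shift[OF W(1)]])
  then obtain a where a: "((\<lambda>(k, l). W l (k + l) * (u k * u l)) has_sum a) ?X"
    by (auto simp: summable_on_def)
  have "(\<lambda>(k, l). (if k < l then W (l - k) l else 0) * (u k * u l)) summable_on ?X"
    by (rule pair[OF poly_bounded_diff1[OF W(1)]])
  then obtain b where b: "((\<lambda>(k, l). (if k < l then W (l - k) l else 0) * (u k
      * u l)) has_sum b) ?X"
    by (auto simp: summable_on_def)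
  have "(\<lambda>(k, l). (if l < k then V l (k - l) else 0) * (u k * u l)) summable_on ?X"
    by (rule pair[OF poly_bounded_diff2[OF V(1)]])
  then obtain c where c: "((\<lambda>(k, l). (if l < k then V l (k - l) else 0) * (u k
      * u l)) has_sum c) ?X"
    by (auto simp: summable_on_def)
  have "(\<lambda>(k, l). W l (k + l) * u (k + l)) summable_on ?X"
    by (rule pair_plus[OF poly_bounded_shift[OF W(1)]])
  then obtain d where d: "((\<lambda>(k, l). W l (k + l) * u (k + l)) has_sum d) ?X"
    by (auto simp: summable_on_def)
  have "(\<lambda>(k, l). V k l * u (k + l)) summable_on ?X" by (rule pair_plus[OF V(1)])
  then obtain e where e: "((\<lambda>(k, l). V k l * u (k + l)) has_sum e) ?X"
    by (auto simp: summable_on_def)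
  have z: "z = 2 * (a - b + c)"
    using has_sum_unique[OF rest] has_sum_cmult_right[OF has_sum_add[OF has_sum_subtract[OF a b]
        c], of 2]
    by (simp add: case_prod_unfold Z_def algebra_simps)

  have d': "((\<lambda>n. \<Sum>l\<in>{1..<n}. W l n * u n) has_sum d) {1..}"
    using d by (intro has_sum_pairs_triangle) simp
  have e': "((\<lambda>n. \<Sum>l\<in>{1..<n}. V l (n - l) * u n) has_sum e) {1..}"
    using e V(2) by (intro has_sum_pairs_triangle) simp

  \<comment> \<open>For \<open>m < n\<close> put \<open>m = l\<close> and \<open>n = k + l\<close>.
    The shifted product formula then gives \<open>a - b - d\<close>, where \<open>b\<close> is first
    rewritten with \<open>k + l\<close> for \<open>l\<close>, which absorbs its condition
    \<open>k < l\<close>.\<close>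
  have upper: "((\<lambda>(m, n). W m n * (u m * u n)) has_sum (a - b - d)) {(m, n) \<in> ?X. m < n}"
  proof -
    have b': "((\<lambda>(k, l). W l (k + l) * (u k * u (k + l))) has_sum b) ?X"
    proof -
      have "((\<lambda>(k, l). W (l - k) l * (u k * u l)) has_sum b) {(k, l) \<in> ?X. k < l}"
        by (rule has_sum_cong_neutral[THEN iffD1, OF _ _ _ b]) (auto split: if_splits)
      then show ?thesis
        by (rule has_sum_reindex_bij_witness[where i = "\<lambda>(k, l). (k, k + l)" and j
        = "\<lambda>(k, l). (k, l - k)",
        THEN iffD1, OF _ _ _ _ _ refl, rotated -1]) auto
    qed
    have "((\<lambda>(k, l). W l (k + l) * (u l * u (k + l))) has_sum (a - b - d)) ?X"
    proof (rule has_sum_cong[THEN iffD1, OF _ has_sum_subtract[OF has_sum_subtract[OF a b'] d]],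
        clarsimp)
      fix k l :: nat assume "Suc 0 \<le> k" "Suc 0 \<le> l"
      then have eq: "u l * u (k + l) = u k * u l - u k * u (k + l) - u (k + l)"
        unfolding u_def by (intro lambert_coeff_mult_shift q) auto
      show "W l (k + l) * (u k * u l) - W l (k + l) * (u k * u (k + l)) - W l (k + l) * u (k + l)
          = W l (k + l) * (u l * u (k + l))"
        unfolding eq by (simp add: algebra_simps)
    qed
    then show ?thesis
      by (rule has_sum_reindex_bij_witness[where j = "\<lambda>(k, l). (l, k + l)" and i = "\<lambda>(m, n). (n
      - m, m)",
        THEN iffD1, OF _ _ _ _ _ refl, rotated -1]) auto
  qed
  have lower: "((\<lambda>(m, n). W m n * (u m * u n)) has_sum (a - b - d)) {(m, n) \<in> ?X. n < m}"
    using upper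
    by (rule has_sum_reindex_bij_witness[where j = "\<lambda>(k, l). (l, k)" and i = "\<lambda>(m, n). (n, m)",
        THEN iffD1, OF _ _ _ _ _ refl, rotated -1])
       (auto simp: W(2) mult.commute)
  have offdiag: "((\<lambda>(m, n). W m n * (u m * u n)) has_sum (a - b - d + (a - b - d)))
      ({(m, n) \<in> ?X. m < n} \<union> {(m, n) \<in> ?X. n < m})"
    by (rule has_sum_Un_disjoint[OF upper lower]) auto
  \<comment> \<open>The diagonal is reached by removing both triangles from the full
    \<open>W\<close>-sum.\<close>
  have "((\<lambda>(m, n). W m n * (u m * u n)) has_sum (sW - (a - b - d + (a - b - d))))
      (?X - ({(m, n) \<in> ?X. m < n} \<union> {(m, n) \<in> ?X. n < m}))"
    by (rule has_sum_Diff[OF sW offdiag]) auto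
  moreover have "?X - ({(m, n) \<in> ?X. m < n} \<union> {(m, n) \<in> ?X. n < m}) = {(m, n). 1 \<le> m \<and> n = m}"
    by auto
  ultimately have "((\<lambda>(m, n). W m n * (u m * u n)) has_sum (sW - (a - b - d + (a - b - d))))
      {(m, n). 1 \<le> m \<and> n = m}" by simp
  then have diag: "((\<lambda>k. W k k * (u k)\<^sup>2) has_sum (sW - (a - b - d + (a - b - d)))) {1..}"
    by (rule has_sum_reindex_bij_witness[where j = fst and i = "\<lambda>k. (k, k)",
        THEN iffD1, OF _ _ _ _ _ refl, rotated -1]) (auto simp: power2_eq_square)

  \<comment> \<open>With \<open>k + l\<close> for \<open>k\<close>, the sum \<open>c\<close> pairs
    \<open>u (k + l)\<close> with \<open>u l\<close>; exchanging the indices pairs it with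
    \<open>u k\<close>. The splitting formula therefore evaluates the full \<open>V\<close>-sum as
    \<open>e + 2 * c\<close>.\<close>
  have c1: "((\<lambda>(k, l). V l k * (u (k + l) * u l)) has_sum c) ?X"
  proof -
    have "((\<lambda>(k, l). V l (k - l) * (u k * u l)) has_sum c) {(k, l) \<in> ?X. l < k}"
      by (rule has_sum_cong_neutral[THEN iffD1, OF _ _ _ c]) (auto split: if_splits)
    then show ?thesis
      by (rule has_sum_reindex_bij_witness[where i = "\<lambda>(k, l). (k + l, l)" and j = "\<lambda>(k, l). (k
      - l, l)",
        THEN iffD1, OF _ _ _ _ _ refl, rotated -1]) auto
  qed
  then have c2: "((\<lambda>(k, l). V k l * (u (k + l) * u k)) has_sum c) ?X"
    by (subst (asm) has_sum_swap) (simp add: add.commute)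
  have "((\<lambda>(k, l). V k l * (u k * u l)) has_sum (e + c + c)) ?X"
  proof (rule has_sum_cong[THEN iffD1, OF _ has_sum_add[OF has_sum_add[OF e c1] c2]], clarsimp)
    fix k l :: nat assume "Suc 0 \<le> k" "Suc 0 \<le> l"
    then have eq: "u k * u l = u (k + l) * (1 + u k + u l)"
      unfolding u_def by (intro lambert_coeff_mult_split q) auto
    show "V k l * u (k + l) + V l k * (u (k + l) * u l) + V k l * (u (k + l) * u k)
        = V k l * (u k * u l)"
      unfolding eq by (simp add: algebra_simps V(2)[of l k])
  qed
  then have sV': "sV = e + 2 * c" using has_sum_unique[OF sV] by auto

  \<comment> \<open>Subtracting \<open>z\<close> removes the bilinear sums and leaves the diagonal
    together with the linear terms \<open>e - 2 * d\<close>.\<close>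
  have eq: "s - z = (sW - (a - b - d + (a - b - d))) + (e - 2 * d)"
    by (simp add: s z sV' algebra_simps)
  show ?thesis
    unfolding eq using has_sum_add[OF diag has_sum_subtract[OF e' has_sum_cmult_right[OF d', of 2]]]
    by (simp add: sum_distrib_left sum_subtractf algebra_simps)
qed

subsection \<open>Convolution identities\<close>

text \<open>For \<open>norm q < 1\<close> this is the generating function of the divisor sums
  \<sigma>_p.\<close>

definition lambert :: "nat \<Rightarrow> complex \<Rightarrow> complex" where
  "lambert p q = (\<Sum>\<^sub>\<infinity>n\<in>{1..}. of_nat n ^ p * lambert_coeff q n)"

text \<open>The squares come from differentiation: q d/dq of u_n is n (u_n + u_n^2), so q d/dq of
  \<open>lambert p\<close> is \<open>lambert (p + 1)\<close> plus
  \<open>lambert_sq (p + 1)\<close>.\<close>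

definition lambert_sq :: "nat \<Rightarrow> complex \<Rightarrow> complex" where
  "lambert_sq p q = (\<Sum>\<^sub>\<infinity>n\<in>{1..}. of_nat n ^ p * (lambert_coeff q n)\<^sup>2)"

lemma lambert_has_sum:
  assumes "norm q < 1"
  shows "((\<lambda>n. of_nat n ^ p * lambert_coeff q n) has_sum lambert p q) {1..}"
    and "((\<lambda>n. of_nat n ^ p * (lambert_coeff q n)\<^sup>2) has_sum lambert_sq p q) {1..}"
  unfolding lambert_def lambert_sq_def
  by (intro has_sum_infsum lambert_summable_on assms)+

lemma lambert_has_sum_product:
  assumes q: "norm q < 1"
    and f: "\<And>n. n \<ge> 1 \<Longrightarrow> norm (f n) \<le> real n ^ a"
    and g: "\<And>n. n \<ge> 1 \<Longrightarrow> norm (g n) \<le> real n ^ b"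
    and F: "((\<lambda>n. f n * lambert_coeff q n) has_sum F) {1..}"
    and G: "((\<lambda>n. g n * lambert_coeff q n) has_sum G) {1..}"
  shows "((\<lambda>(m, n). f m * g n * (lambert_coeff q m * lambert_coeff q n)) has_sum F
      * G) ({1..} \<times> {1..})"
proof (rule has_sum_SigmaI)
  show "((\<lambda>n. case (m, n) of (m, n) \<Rightarrow> f m * g n * (lambert_coeff q m * lambert_coeff q n))
      has_sum (f m * lambert_coeff q m) * G) {1..}" for m
    using has_sum_cmult_right[OF G, of "f m * lambert_coeff q m"] by (simp add: mult_ac)
  show "((\<lambda>m. f m * lambert_coeff q m * G) has_sum F * G) {1..}"
    by (rule has_sum_cmult_left[OF F])
  show "(\<lambda>(m, n). f m * g n * (lambert_coeff q m * lambert_coeff q n)) summable_on {1..} \<times> {1..}"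
  proof (rule lambert_pair_summable_on(1)[OF q], rule poly_boundedI[where C = 1 and p = "a + b"])
    fix m n :: nat assume mn: "1 \<le> m" "1 \<le> n"
    have "norm (f m) * norm (g n) \<le> real m ^ a * real n ^ b"
      using f g mn by (intro mult_mono) auto
    also have "\<dots> \<le> real m ^ (a + b) * real n ^ (a + b)"
      using mn by (intro mult_mono power_increasing) auto
    finally show "norm (f m * g n) \<le> 1 * (real m * real n) ^ (a + b)"
      by (simp add: norm_mult power_mult_distrib)
  qed
qed

lemma lambert_has_sum_power_product:
  assumes "norm q < 1"
  shows "((\<lambda>(m, n). of_nat m ^ a * of_nat n ^ b * (lambert_coeff q m * lambert_coeff q n))
      has_sum lambert a q * lambert b q) ({1..} \<times> {1..})"
  by (rule lambert_has_sum_product[OF assms _ _ lambert_has_sum(1)[OF assms] lambert_has_sum(1)[OF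
      assms]])
     (auto simp: norm_power)

text \<open>With truncated subtraction, \<open>m - n + (n - m)\<close> is |m - n|. The bound by a
  power of \<open>Suc n\<close> admits a nonzero value of \<open>f\<close> at 0, and
  \<open>m + n + 1\<close> is at most \<open>3 * m * n\<close>.\<close>

lemma poly_bounded_absdiff_add:
  fixes f :: "nat \<Rightarrow> complex"
  assumes "\<And>n. norm (f n) \<le> real (Suc n) ^ p"
  shows "poly_bounded (\<lambda>m n. f (m - n + (n - m)))" "poly_bounded (\<lambda>m n. f (m + n))"
proof -
  have *: "norm (f i) \<le> 3 ^ p * (real m * real n) ^ p" if "1 \<le> m" "1 \<le> n" "i \<le> m + n" for i m n
  proof -
    have "1 \<le> real m" "1 \<le> real n" using that by auto
    then have "1 * real n \<le> real m * real n" "real m * 1 \<le> real m * real n" "1 * 1 \<le> real m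
        * real n"
      by (intro mult_mono; simp)+
    then have "real (Suc i) \<le> 3 * (real m * real n)" using that(3) by linarith
    then have "real (Suc i) ^ p \<le> (3 * (real m * real n)) ^ p" by (intro power_mono) auto
    then show ?thesis using assms[of i] by (simp add: power_mult_distrib)
  qed
  show "poly_bounded (\<lambda>m n. f (m - n + (n - m)))" "poly_bounded (\<lambda>m n. f (m + n))"
    by (rule poly_boundedI[where C = "3 ^ p" and p = p]; rule *; simp)+
qed

lemma poly_bounded_uminus: "poly_bounded F \<Longrightarrow> poly_bounded (\<lambda>m n. - F m n)"
  by (simp add: poly_bounded_def)

lemma poly_bounded_times_index:
  assumes "poly_bounded F"
  shows "poly_bounded (\<lambda>m n. of_nat m * of_nat n * F m n)"
proof -
  obtain C p where C: "C \<ge> 0" "\<And>m n. m \<ge> 1 \<Longrightarrow> n \<ge> 1 \<Longrightarrow> norm (F m n) \<le> C * (real m * real n) ^ p"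
    using poly_boundedE[OF assms] by blast
  show ?thesis
  proof (rule poly_boundedI)
    fix m n :: nat assume "1 \<le> m" "1 \<le> n"
    then have "(real m * real n) * norm (F m n) \<le> (real m * real n) * (C * (real m * real n) ^ p)"
      by (intro mult_left_mono C(2)) auto
    then show "norm (of_nat m * of_nat n * F m n) \<le> C * (real m * real n) ^ Suc p"
      by (simp add: norm_mult mult_ac)
  qed
qed

text \<open>For the weights f(|m - n|) and -f(m + n) the bilinear part vanishes off the diagonal:
  for \<open>k < l\<close> the two \<open>W\<close>-terms are both \<open>f k\<close>, and for
  \<open>l < k\<close> the \<open>V\<close>-term cancels \<open>f k\<close>. On the diagonal
  \<open>2 * f k\<close> survives, hence the correction \<open>2 * t\<close>.\<close>

proposition lambert_liouville_identity:
  fixes f :: "nat \<Rightarrow> complex" and q :: complex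
  defines "u \<equiv> lambert_coeff q"
  assumes q: "norm q < 1"
    and f: "\<And>n. norm (f n) \<le> real (Suc n) ^ p"
    and lhs: "((\<lambda>(m, n). (f (m - n + (n - m)) - f (m + n)) * (u m
        * u n)) has_sum s) ({1..} \<times> {1..})"
    and diag: "((\<lambda>k. f k * (u k)\<^sup>2) has_sum t) {1..}"
  shows "((\<lambda>k. f 0 * (u k)\<^sup>2 - u k * ((of_nat k - 1) * f k + 2 * (\<Sum>j\<in>{1..<k}. f j)))
          has_sum (s - 2 * t)) {1..}"
proof -
  let ?W = "\<lambda>m n. f (m - n + (n - m))" and ?V = "\<lambda>m n. - f (m + n)"
  have t: "((\<lambda>(k, l). 2 * (?W l (k + l) - (if k < l then ?W (l - k) l else 0)
      + (if l < k then ?V l (k - l) else 0)) * (u k * u l)) has_sum 2 * t) ({1..} \<times> {1..})"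
  proof -
    have "((\<lambda>(k, l). 2 * f k * (u k * u l)) has_sum 2 * t) {(k, l). 1 \<le> k \<and> l = k}"
      using has_sum_cmult_right[OF diag, of 2]
      by (rule has_sum_reindex_bij_witness[where i = fst and j = "\<lambda>k. (k, k)",
          THEN iffD1, OF _ _ _ _ _ refl, rotated -1]) (auto simp: power2_eq_square)
    moreover have "2 * (?W l (k + l) - (if k < l then ?W (l - k) l else 0)
        + (if l < k then ?V l (k - l) else 0)) = (if l = k then 2 * f k else 0)" for k l
      by (cases k l rule: linorder_cases) auto
    ultimately show ?thesis
      by (elim has_sum_cong_neutral[THEN iffD1, rotated -1]) (auto split: if_splits)
  qed
  have A: "((\<lambda>k. ?W k k * (u k)\<^sup>2 + u k * (\<Sum>l\<in>{1..<k}. ?V l (k - l) - 2 * ?W l k))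
      has_sum (s - 2 * t)) {1..}"
    unfolding u_def
    by (rule lambert_pair_sum_regroup[OF q poly_bounded_absdiff_add(1)[OF f] _
          poly_bounded_uminus[OF poly_bounded_absdiff_add(2)[OF f]]])
       (use lhs t in \<open>auto simp: u_def add.commute\<close>)
  have eq: "(\<Sum>l\<in>{1..<k}. ?V l (k - l) - 2 * ?W l k)
      = - ((of_nat k - 1) * f k + 2 * (\<Sum>j\<in>{1..<k}. f j))" if "1 \<le> k" for k
  proof -
    have "(\<Sum>l\<in>{1..<k}. ?V l (k - l) - 2 * ?W l k) = (\<Sum>l\<in>{1..<k}. - f k - 2 * f (k - l))"
      by (intro sum.cong) auto
    also have "\<dots> = - (of_nat k - 1) * f k - 2 * (\<Sum>l\<in>{1..<k}. f (k - l))"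
      using that by (simp add: sum_subtractf sum_distrib_left sum_negf of_nat_diff minus_mult_left)
    also have "(\<Sum>l\<in>{1..<k}. f (k - l)) = (\<Sum>j\<in>{1..<k}. f j)"
      by (rule sum.reindex_bij_witness[of _ "\<lambda>l. k - l" "\<lambda>l. k - l"]) auto
    finally show ?thesis by (simp only: minus_add_distrib minus_mult_left diff_conv_add_uminus)
  qed
  show ?thesis
    by (rule has_sum_cong[THEN iffD1, OF _ A]) (simp only: eq atLeast_iff, simp add: algebra_simps)
qed

text \<open>With the extra factor \<open>m * n\<close> and a plus sign, the bilinear weight is
  \<open>4 * k * f k * l\<close> throughout: \<open>(k + l) - (l - k)\<close> for
  \<open>k < l\<close> and \<open>(k + l) + (k - l)\<close> for \<open>l < k\<close> both equal
  \<open>2 * k\<close>. The bilinear part is thus a product of two single series.\<close>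

proposition lambert_weighted_identity:
  fixes f :: "nat \<Rightarrow> complex" and q :: complex
  defines "u \<equiv> lambert_coeff q"
  assumes q: "norm q < 1"
    and f: "\<And>n. norm (f n) \<le> real (Suc n) ^ p"
    and lhs: "((\<lambda>(m, n). of_nat m * of_nat n * (f (m - n + (n - m)) + f (m + n)) * (u m * u n))
                has_sum s) ({1..} \<times> {1..})"
    and prod: "((\<lambda>(k, l). of_nat k * f k * of_nat l * (u k * u l)) has_sum t) ({1..} \<times> {1..})"
  shows "((\<lambda>k. (of_nat k)\<^sup>2 * f 0 * (u k)\<^sup>2 + u k * (f k * (\<Sum>l\<in>{1..<k}. of_nat l * (of_nat k
      - of_nat l))
            - 2 * of_nat k * (\<Sum>l\<in>{1..<k}. (of_nat k - of_nat l) * f l))) has_sum (s - 4 * t)) {1..}"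
proof -
  let ?W = "\<lambda>m n. of_nat m * of_nat n * f (m - n + (n - m))"
    and ?V = "\<lambda>m n. of_nat m * of_nat n * f (m + n)"
  have t: "((\<lambda>(k, l). 2 * (?W l (k + l) - (if k < l then ?W (l - k) l else 0)
      + (if l < k then ?V l (k - l) else 0)) * (u k * u l)) has_sum 4 * t) ({1..} \<times> {1..})"
  proof (rule has_sum_cong[THEN iffD1, OF _ has_sum_cmult_right[OF prod]], clarify)
    fix k l :: nat
    consider "k < l" | "l < k" | "k = l" by linarith
    then show "4 * (of_nat k * f k * of_nat l * (u k * u l)) =
        2 * (?W l (k + l) - (if k < l then ?W (l - k) l else 0)
          + (if l < k then ?V l (k - l) else 0)) * (u k * u l)"
      by cases (auto simp: of_nat_diff algebra_simps)
  qed
  have "((\<lambda>k. ?W k k * (u k)\<^sup>2 + u k * (\<Sum>l\<in>{1..<k}. ?V l (k - l) - 2 * ?W l k))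
      has_sum (s - 4 * t)) {1..}"
    unfolding u_def
    by (rule lambert_pair_sum_regroup[OF q poly_bounded_times_index[OF
        poly_bounded_absdiff_add(1)[OF f]] _
          poly_bounded_times_index[OF poly_bounded_absdiff_add(2)[OF f]]])
       (use lhs t in \<open>auto simp: u_def add.commute algebra_simps\<close>)
  moreover have "(\<Sum>l\<in>{1..<k}. ?V l (k - l) - 2 * ?W l k)
      = f k * (\<Sum>l\<in>{1..<k}. of_nat l * (of_nat k - of_nat l))
        - 2 * of_nat k * (\<Sum>l\<in>{1..<k}. (of_nat k - of_nat l) * f l)" for k
  proof -
    have "(\<Sum>l\<in>{1..<k}. ?V l (k - l) - 2 * ?W l k)
        = (\<Sum>l\<in>{1..<k}. f k * (of_nat l * (of_nat k - of_nat l)) - 2 * of_nat k * (of_nat l * f (k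
        - l)))"
      by (intro sum.cong) (auto simp: of_nat_diff algebra_simps)
    also have "\<dots> = f k * (\<Sum>l\<in>{1..<k}. of_nat l * (of_nat k - of_nat l))
        - 2 * of_nat k * (\<Sum>l\<in>{1..<k}. of_nat l * f (k - l))"
      by (simp only: sum_subtractf sum_distrib_left)
    also have "(\<Sum>l\<in>{1..<k}. of_nat l * f (k - l)) = (\<Sum>l\<in>{1..<k}. (of_nat k - of_nat l) * f l)"
      by (rule sum.reindex_bij_witness[of _ "\<lambda>l. k - l" "\<lambda>l. k - l"]) (auto simp: of_nat_diff)
    finally show ?thesis .
  qed
  ultimately show ?thesis
    by (simp add: power2_eq_square)
qed

section \<open>Power sums and the classical convolutions\<close>

lemma sum_powers_below:
  fixes k :: nat
  shows "(\<Sum>j<k. (of_nat j :: complex)) = (of_nat k ^ 2 - of_nat k) / 2"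
    and "(\<Sum>j<k. (of_nat j :: complex) ^ 2) = (2 * of_nat k ^ 3 - 3 * of_nat k ^ 2 + of_nat k) / 6"
    and "(\<Sum>j<k. (of_nat j :: complex) ^ 4)
         = (6 * of_nat k ^ 5 - 15 * of_nat k ^ 4 + 10 * of_nat k ^ 3 - of_nat k) / 30"
    and "(\<Sum>j<k. (of_nat j :: complex) ^ 5)
         = (2 * of_nat k ^ 6 - 6 * of_nat k ^ 5 + 5 * of_nat k ^ 4 - of_nat k ^ 2) / 12"
    and "(\<Sum>j<k. (of_nat j :: complex) ^ 6)
         = (6 * of_nat k ^ 7 - 21 * of_nat k ^ 6 + 21 * of_nat k ^ 5 - 7 * of_nat k ^ 3
         + of_nat k) / 42"
  by (induction k) (simp_all add: field_simps eval_nat_numeral)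

lemma sum_from_one_below:
  fixes g :: "nat \<Rightarrow> complex"
  assumes "g 0 = 0"
  shows "(\<Sum>j\<in>{Suc 0..<k}. g j) = (\<Sum>j<k. g j)"
  using assms by (intro sum.mono_neutral_left) (auto simp: Suc_le_eq)

lemma even_power_absdiff:
  assumes "even p"
  shows "(of_nat (m - n + (n - m)) :: complex) ^ p = (of_nat m - of_nat n) ^ p"
proof (cases m n rule: le_cases)
  case le
  then have "(of_nat (m - n + (n - m)) :: complex) = - (of_nat m - of_nat n)"
    by (simp add: of_nat_diff)
  then show ?thesis using assms by (simp only: power_minus_even)
qed (simp add: of_nat_diff)

lemma norm_of_nat_power_le_Suc: "norm ((of_nat n :: complex) ^ p) \<le> real (Suc n) ^ p"
  by (simp add: norm_power power_mono)

text \<open>The choice f(n) = n^p. As \<open>p\<close> is positive, \<open>f 0\<close> vanishes, and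
  \<open>lambert_sq\<close> enters only through \<open>t\<close>. As \<open>p\<close> is even, the
  kernel has only odd powers of \<open>m\<close> and \<open>n\<close>, so in the applications
  \<open>s\<close> is a combination of products of two Lambert series of odd index.\<close>

lemma lambert_liouville_power:
  assumes q: "norm q < 1" and p: "even p" "p > 0"
    and s: "((\<lambda>(m, n). ((of_nat m - of_nat n) ^ p - (of_nat m + of_nat n) ^ p)
               * (lambert_coeff q m * lambert_coeff q n)) has_sum s) ({1..} \<times> {1..})"
  shows "((\<lambda>k. lambert_coeff q k * ((of_nat k - 1) * of_nat k ^ p + 2 * (\<Sum>j<k. of_nat j ^ p)))
          has_sum (2 * lambert_sq p q - s)) {1..}"
proof -
  have "((\<lambda>(m, n). (of_nat (m - n + (n - m)) ^ p - of_nat (m + n) ^ p)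
      * (lambert_coeff q m * lambert_coeff q n)) has_sum s) ({1..} \<times> {1..})"
    unfolding even_power_absdiff[OF p(1)] unfolding of_nat_add by (rule s)
  from lambert_liouville_identity[OF q norm_of_nat_power_le_Suc this lambert_has_sum(2)[OF q]]
  have "((\<lambda>k. of_nat 0 ^ p * (lambert_coeff q k)\<^sup>2 - lambert_coeff q k * ((of_nat k - 1)
      * of_nat k ^ p
      + 2 * (\<Sum>j\<in>{1..<k}. of_nat j ^ p))) has_sum (s - 2 * lambert_sq p q)) {1..}" .
  from has_sum_uminusI[OF this] show ?thesis
    using p by (simp add: sum_from_one_below zero_power)
qed

lemma has_sum_eq_of_cong:
  fixes f g :: "'a \<Rightarrow> complex"
  assumes "(f has_sum a) A" "(g has_sum b) A" "\<And>x. x \<in> A \<Longrightarrow> f x = g x"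
  shows "a = b"
  using assms has_sum_cong has_sum_unique by metis

text \<open>The case \<open>p = 2\<close>. Moving \<open>2 * lambert 2 q\<close> to the left
  completes \<open>2 * lambert_sq 2 q\<close> to twice the derivative of \<open>lambert 1\<close>;
  the cases \<open>p = 4\<close> and \<open>p = 6\<close> below serve \<open>lambert 3\<close> and
  \<open>lambert 5\<close> in the same way.\<close>

lemma lambert_convolution_1_1:
  assumes q: "norm q < 1"
  shows "2 * lambert_sq 2 q + 4 * lambert 1 q * lambert 1 q
         = 5/3 * lambert 3 q - 2 * lambert 2 q + 1/3 * lambert 1 q"
proof -
  note S = lambert_has_sum(1)[OF q] and P = lambert_has_sum_power_product[OF q]
  have "((\<lambda>(m, n). ((of_nat m - of_nat n) ^ 2 - (of_nat m + of_nat n) ^ 2)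
          * (lambert_coeff q m * lambert_coeff q n)) has_sum (- 4 * (lambert 1 q
          * lambert 1 q))) ({1..} \<times> {1..})"
    by (rule has_sum_cong[THEN iffD1, OF _ has_sum_cmult_right[OF P, of "- 4" 1 1]])
       (auto simp: power2_eq_square algebra_simps)
  from lambert_liouville_power[OF q _ _ this]
  have "((\<lambda>k. lambert_coeff q k * ((of_nat k - 1) * of_nat k ^ 2 + 2 * (\<Sum>j<k. of_nat j ^ 2)))
          has_sum (2 * lambert_sq 2 q - - 4 * (lambert 1 q * lambert 1 q))) {1..}" by simp
  moreover have "((\<lambda>k. 5/3 * (of_nat k ^ 3 * lambert_coeff q k) - 2 * (of_nat k ^ 2
      * lambert_coeff q k)
      + 1/3 * (of_nat k ^ 1 * lambert_coeff q k)) has_sum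
      (5/3 * lambert 3 q - 2 * lambert 2 q + 1/3 * lambert 1 q)) {1..}"
    by (intro has_sum_add has_sum_subtract has_sum_cmult_right S)
  ultimately have "2 * lambert_sq 2 q - - 4 * (lambert 1 q * lambert 1 q)
      = 5/3 * lambert 3 q - 2 * lambert 2 q + 1/3 * lambert 1 q"
    by (rule has_sum_eq_of_cong)
       (unfold sum_powers_below, simp add: field_simps eval_nat_numeral)
  then show ?thesis by (simp add: mult_ac)
qed

lemma lambert_convolution_1_3:
  assumes q: "norm q < 1"
  shows "2 * lambert_sq 4 q + 16 * lambert 1 q * lambert 3 q
         = 7/5 * lambert 5 q - 2 * lambert 4 q + 2/3 * lambert 3 q - 1/15 * lambert 1 q"
proof -
  note S = lambert_has_sum(1)[OF q] and P = lambert_has_sum_power_product[OF q]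
  have "((\<lambda>(m, n). ((of_nat m - of_nat n) ^ 4 - (of_nat m + of_nat n) ^ 4)
          * (lambert_coeff q m * lambert_coeff q n)) has_sum
        (- 8 * (lambert 1 q * lambert 3 q) + - 8 * (lambert 3 q * lambert 1 q))) ({1..} \<times> {1..})"
    by (rule has_sum_cong[THEN iffD1, OF _ has_sum_add[OF
          has_sum_cmult_right[OF P, of "- 8" 1 3] has_sum_cmult_right[OF P, of "- 8" 3 1]]])
       (auto simp: eval_nat_numeral algebra_simps)
  from lambert_liouville_power[OF q _ _ this]
  have "((\<lambda>k. lambert_coeff q k * ((of_nat k - 1) * of_nat k ^ 4 + 2 * (\<Sum>j<k. of_nat j ^ 4)))
          has_sum (2 * lambert_sq 4 q - (- 8 * (lambert 1 q * lambert 3 q) + - 8 * (lambert 3 q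
          * lambert 1 q)))) {1..}"
    by simp
  moreover have "((\<lambda>k. 7/5 * (of_nat k ^ 5 * lambert_coeff q k) - 2 * (of_nat k ^ 4
      * lambert_coeff q k)
      + 2/3 * (of_nat k ^ 3 * lambert_coeff q k) - 1/15 * (of_nat k ^ 1
      * lambert_coeff q k)) has_sum
      (7/5 * lambert 5 q - 2 * lambert 4 q + 2/3 * lambert 3 q - 1/15 * lambert 1 q)) {1..}"
    by (intro has_sum_add has_sum_subtract has_sum_cmult_right S)
  ultimately have "2 * lambert_sq 4 q - (- 8 * (lambert 1 q * lambert 3 q) + - 8 * (lambert 3 q
      * lambert 1 q))
      = 7/5 * lambert 5 q - 2 * lambert 4 q + 2/3 * lambert 3 q - 1/15 * lambert 1 q"
    by (rule has_sum_eq_of_cong)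
       (unfold sum_powers_below, simp add: field_simps eval_nat_numeral)
  then show ?thesis by (simp add: mult_ac)
qed

text \<open>For \<open>p = 6\<close> the kernel also has a cubic-cubic term, hence the square of
  \<open>lambert 3\<close>; the term in \<open>lambert 7\<close> is eliminated later by
  \<open>lambert_convolution_3_3\<close>.\<close>

lemma lambert_convolution_1_5:
  assumes q: "norm q < 1"
  shows "2 * lambert_sq 6 q + 24 * lambert 1 q * lambert 5 q + 40 * lambert 3 q * lambert 3 q
         = 9/7 * lambert 7 q - 2 * lambert 6 q + lambert 5 q - 1/3 * lambert 3 q + 1/21
         * lambert 1 q"
proof -
  note S = lambert_has_sum(1)[OF q] and P = lambert_has_sum_power_product[OF q]
  let ?s = "- 12 * (lambert 1 q * lambert 5 q) + - 40 * (lambert 3 q * lambert 3 q) + - 12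
      * (lambert 5 q * lambert 1 q)"
  have "((\<lambda>(m, n). ((of_nat m - of_nat n) ^ 6 - (of_nat m + of_nat n) ^ 6)
          * (lambert_coeff q m * lambert_coeff q n)) has_sum ?s) ({1..} \<times> {1..})"
    by (rule has_sum_cong[THEN iffD1, OF _ has_sum_add[OF has_sum_add[OF
          has_sum_cmult_right[OF P, of "- 12" 1 5] has_sum_cmult_right[OF P, of "- 40" 3 3]]
          has_sum_cmult_right[OF P, of "- 12" 5 1]]])
       (auto simp: eval_nat_numeral algebra_simps)
  from lambert_liouville_power[OF q _ _ this]
  have "((\<lambda>k. lambert_coeff q k * ((of_nat k - 1) * of_nat k ^ 6 + 2 * (\<Sum>j<k. of_nat j ^ 6)))
          has_sum (2 * lambert_sq 6 q - ?s)) {1..}"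
    by simp
  moreover have "((\<lambda>k. 9/7 * (of_nat k ^ 7 * lambert_coeff q k) - 2 * (of_nat k ^ 6
      * lambert_coeff q k)
      + 1 * (of_nat k ^ 5 * lambert_coeff q k)
      - 1/3 * (of_nat k ^ 3 * lambert_coeff q k) + 1/21 * (of_nat k ^ 1
      * lambert_coeff q k)) has_sum
      (9/7 * lambert 7 q - 2 * lambert 6 q + 1 * lambert 5 q - 1/3 * lambert 3 q + 1/21
      * lambert 1 q)) {1..}"
    by (intro has_sum_add has_sum_subtract has_sum_cmult_right S)
  ultimately have "2 * lambert_sq 6 q - ?s
      = 9/7 * lambert 7 q - 2 * lambert 6 q + 1 * lambert 5 q - 1/3 * lambert 3 q + 1/21
      * lambert 1 q"
    by (rule has_sum_eq_of_cong)
       (unfold sum_powers_below, simp add: field_simps eval_nat_numeral)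
  then show ?thesis by (simp add: algebra_simps)
qed

lemma sum_times_diff_below:
  "(\<Sum>l\<in>{1..<k}. of_nat l * (of_nat k - of_nat l)) = (of_nat k ^ 3 - of_nat k :: complex) / 6"
proof -
  have "(\<Sum>l\<in>{1..<k}. of_nat l * (of_nat k - of_nat l))
      = (of_nat k * (\<Sum>l<k. of_nat l) - (\<Sum>l<k. of_nat l ^ 2) :: complex)"
    by (simp add: sum_from_one_below algebra_simps sum_subtractf sum_distrib_left power2_eq_square)
  then show ?thesis
    unfolding sum_powers_below by (simp add: field_simps eval_nat_numeral)
qed

text \<open>This is E4^2 = E8 with E8 = 1 + 480 \<open>lambert 7\<close>. For f(n) = n^4 the kernel
  is 2 m^5 n + 12 m^3 n^3 + 2 m n^5, and subtracting \<open>4 * t\<close> cancels exactly the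
  products of \<open>lambert 1\<close> and \<open>lambert 5\<close>.\<close>

lemma lambert_convolution_3_3:
  assumes q: "norm q < 1"
  shows "12 * lambert 3 q * lambert 3 q = 1/10 * lambert 7 q - 1/10 * lambert 3 q"
proof -
  note S = lambert_has_sum(1)[OF q] and P = lambert_has_sum_power_product[OF q]
  let ?s = "2 * (lambert 1 q * lambert 5 q) + 12 * (lambert 3 q * lambert 3 q) + 2 * (lambert 5 q
      * lambert 1 q)"
  have "((\<lambda>(m, n). of_nat m * of_nat n * ((of_nat m - of_nat n) ^ 4 + (of_nat m + of_nat n) ^ 4)
          * (lambert_coeff q m * lambert_coeff q n)) has_sum ?s) ({1..} \<times> {1..})"
    by (rule has_sum_cong[THEN iffD1, OF _ has_sum_add[OF has_sum_add[OF
          has_sum_cmult_right[OF P, of 2 1 5] has_sum_cmult_right[OF P, of 12 3 3]]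
          has_sum_cmult_right[OF P, of 2 5 1]]])
       (auto simp: eval_nat_numeral algebra_simps)
  then have s: "((\<lambda>(m, n). of_nat m * of_nat n * (of_nat (m - n + (n - m)) ^ 4 + of_nat (m + n) ^ 4)
          * (lambert_coeff q m * lambert_coeff q n)) has_sum ?s) ({1..} \<times> {1..})"
    by (subst even_power_absdiff) auto
  have t: "((\<lambda>(k, l). of_nat k * of_nat k ^ 4 * of_nat l * (lambert_coeff q k * lambert_coeff q l))
      has_sum (lambert 5 q * lambert 1 q)) ({1..} \<times> {1..})"
    using P[of 5 1] by (simp add: eval_nat_numeral)
  have sum: "(\<Sum>l\<in>{1..<k}. (of_nat k - of_nat l) * of_nat l ^ 4)
      = (of_nat k * (\<Sum>l<k. of_nat l ^ 4) - (\<Sum>l<k. of_nat l ^ 5) :: complex)" for k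
    by (simp add: sum_from_one_below algebra_simps sum_subtractf sum_distrib_left flip: power_Suc)
  have "((\<lambda>k. (of_nat k)\<^sup>2 * of_nat 0 ^ 4 * (lambert_coeff q k)\<^sup>2 + lambert_coeff q k *
       (of_nat k ^ 4 * (\<Sum>l\<in>{1..<k}. of_nat l * (of_nat k - of_nat l))
            - 2 * of_nat k * (\<Sum>l\<in>{1..<k}. (of_nat k - of_nat l) * of_nat l ^ 4)))
       has_sum (?s - 4 * (lambert 5 q * lambert 1 q))) {1..}"
    by (rule lambert_weighted_identity[OF q norm_of_nat_power_le_Suc s t])
  moreover have "((\<lambda>k. 1/10 * (of_nat k ^ 7 * lambert_coeff q k) - 1/10 * (of_nat k ^ 3
      * lambert_coeff q k))
      has_sum (1/10 * lambert 7 q - 1/10 * lambert 3 q)) {1..}"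
    by (intro has_sum_subtract has_sum_cmult_right S)
  ultimately have "?s - 4 * (lambert 5 q * lambert 1 q) = 1/10 * lambert 7 q - 1/10 * lambert 3 q"
    by (rule has_sum_eq_of_cong)
       (unfold sum_times_diff_below sum sum_powers_below, simp add: field_simps eval_nat_numeral)
  then show ?thesis by (simp add: algebra_simps)
qed

section \<open>Convolution over the integers prime to 3\<close>

definition coprime3 :: "nat \<Rightarrow> complex" where
  "coprime3 n = (if 3 dvd n then 0 else 1)"

lemma coprime3_0 [simp]: "coprime3 0 = 0"
  by (simp add: coprime3_def)

lemma norm_coprime3_le: "norm (coprime3 n) \<le> 1"
  by (simp add: coprime3_def)

lemma coprime3_consecutive: "coprime3 k + coprime3 (Suc k) + coprime3 (Suc (Suc k)) = 2"
  by (simp add: coprime3_def) presburger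

text \<open>The count is 2k/3 plus a 3-periodic correction. Expressing the correction by two
  neighbouring values of \<open>coprime3\<close> avoids a case split modulo 3: the induction closes
  with \<open>coprime3_consecutive\<close>.\<close>

lemma sum_coprime3: "(\<Sum>j<k. coprime3 j) = (2 * of_nat k - 1 - coprime3 k + coprime3 (k - 1)) / 3"
  if "k > 0"
  using that
proof (induction k rule: nat_induct_non_zero)
  case 1
  then show ?case by (simp add: coprime3_def)
next
  case (Suc k)
  then have eq: "coprime3 (Suc k) = 2 - coprime3 k - coprime3 (k - 1)"
    using coprime3_consecutive[of "k - 1"] by (simp add: algebra_simps)
  show ?case
    unfolding sum.lessThan_Suc Suc.IH eq by (simp add: field_simps)
qed

text \<open>Passing from \<open>k\<close> to \<open>Suc k\<close> adds the count from
  \<open>sum_coprime3\<close>, whose periodic corrections telescope.\<close>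

lemma sum_diff_coprime3_lessThan:
  "(\<Sum>l<k. (of_nat k - of_nat l) * coprime3 l) = (of_nat k ^ 2 - coprime3 k) / 3"
proof (induction k)
  case (Suc k)
  have "(\<Sum>l<Suc k. (of_nat (Suc k) - of_nat l) * coprime3 l)
      = (\<Sum>l<k. (of_nat k - of_nat l) * coprime3 l) + (\<Sum>l<Suc k. coprime3 l)"
    by (simp add: algebra_simps sum.distrib sum_subtractf)
  also have "\<dots> = (of_nat (Suc k) ^ 2 - coprime3 (Suc k)) / 3"
    unfolding Suc sum_coprime3[OF zero_less_Suc] by (simp add: field_simps power2_eq_square)
  finally show ?case .
qed simp

lemma sum_diff_coprime3:
  "(\<Sum>l\<in>{1..<k}. (of_nat k - of_nat l) * coprime3 l) = (of_nat k ^ 2 - coprime3 k) / 3"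
  using sum_diff_coprime3_lessThan[of k] by (simp add: sum_from_one_below)

text \<open>The terms at multiples of 3 are removed: the Lambert coefficient of \<open>q\<close> at
  \<open>3 * n\<close> is that of \<open>q ^ 3\<close> at \<open>n\<close>.\<close>

lemma lambert_coprime3_has_sum:
  assumes q: "norm q < 1"
  shows "((\<lambda>n. coprime3 n * (of_nat n ^ p * lambert_coeff q n)) has_sum
          (lambert p q - 3 ^ p * lambert p (q ^ 3))) {1..}"
proof -
  have "norm (q ^ 3) < 1" using q by (simp add: norm_power power_less_one_iff)
  from has_sum_cmult_right[OF lambert_has_sum(1)[OF this, of p], of "3 ^ p"]
  have "((\<lambda>n. of_nat n ^ p * lambert_coeff q n) has_sum 3 ^ p
      * lambert p (q ^ 3)) {n. 1 \<le> n \<and> 3 dvd n}"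
    by (rule has_sum_reindex_bij_witness[where j = "\<lambda>n. 3 * n" and i = "\<lambda>n. n div 3",
        THEN iffD1, OF _ _ _ _ _ refl, rotated -1])
       (auto simp: lambert_coeff_def power_mult power_mult_distrib)
  then have "((\<lambda>n. of_nat n ^ p * lambert_coeff q n) has_sum (lambert p q - 3 ^ p
      * lambert p (q ^ 3)))
      ({1..} - {n. 1 \<le> n \<and> 3 dvd n})"
    by (intro has_sum_Diff lambert_has_sum(1)[OF q]) auto
  then show ?thesis
    by (rule has_sum_cong_neutral[THEN iffD1, rotated -1]) (auto simp: coprime3_def split:
        if_splits)
qed

text \<open>The weighted identity for \<open>coprime3\<close>. The products of \<open>K 1\<close>
  and \<open>lambert 1\<close> cancel against \<open>4 * t\<close>, so that only the square of
  \<open>K 1\<close> stays on the left.\<close>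

lemma lambert_convolution_coprime3:
  assumes q: "norm q < 1"
  defines "K \<equiv> (\<lambda>p. lambert p q - 3 ^ p * lambert p (q ^ 3))"
  shows "3 * K 1 * K 1 = 2/3 * lambert 3 q - 1/6 * K 3 - 1/2 * K 1"
proof -
  have S: "((\<lambda>n. of_nat n * lambert_coeff q n) has_sum lambert 1 q) {1..}"
    using lambert_has_sum(1)[OF q, of 1] by simp
  have K: "((\<lambda>n. coprime3 n * (of_nat n ^ p * lambert_coeff q n)) has_sum K p) {1..}" for p
    unfolding K_def by (rule lambert_coprime3_has_sum[OF q])
  have K1: "((\<lambda>n. of_nat n * coprime3 n * lambert_coeff q n) has_sum K 1) {1..}"
    using K[of 1] by (simp add: mult_ac)
  have P1: "((\<lambda>(m, n). of_nat m * coprime3 m * of_nat n * (lambert_coeff q m * lambert_coeff q n))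
      has_sum K 1 * lambert 1 q) ({1..} \<times> {1..})"
    by (rule lambert_has_sum_product[OF q, where a = 1 and b
        = 1, OF _ _ K1 S]) (use norm_coprime3_le in \<open>auto simp: norm_mult mult_left_le\<close>)
  have P2: "((\<lambda>(m, n). of_nat m * (of_nat n * coprime3 n) * (lambert_coeff q m * lambert_coeff q n))
      has_sum lambert 1 q * K 1) ({1..} \<times> {1..})"
    by (rule lambert_has_sum_product[OF q, where a = 1 and b
        = 1, OF _ _ S K1]) (use norm_coprime3_le in \<open>auto simp: norm_mult mult_left_le\<close>)
  have P3: "((\<lambda>(m, n). of_nat m * coprime3 m * (of_nat n * coprime3 n) * (lambert_coeff q m
      * lambert_coeff q n))
      has_sum K 1 * K 1) ({1..} \<times> {1..})"
    by (rule lambert_has_sum_product[OF q, where a = 1 and b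
        = 1, OF _ _ K1 K1]) (use norm_coprime3_le in \<open>auto simp: norm_mult mult_left_le\<close>)
  let ?s = "2 * (K 1 * lambert 1 q) + 2 * (lambert 1 q * K 1) - 3 * (K 1 * K 1)"
  \<comment> \<open>If \<open>m\<close> and \<open>n\<close> are both prime to 3, exactly one of m -
    n and m + n is divisible by 3; if only one of them is prime to 3, neither is; if none is, both
    are.\<close>
  have f: "coprime3 (m - n + (n - m)) + coprime3 (m + n) = 2 * coprime3 m + 2 * coprime3 n - 3
      * coprime3 m * coprime3 n"
    for m n
  proof -
    obtain i j where i: "i = m mod 3" and j: "j = n mod 3" by blast
    have "3 dvd m - n + (n - m) \<longleftrightarrow> i = j"
      unfolding i j by (cases m n rule: le_cases) (auto simp flip: mod_eq_dvd_iff_nat)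
    moreover have "3 dvd m + n \<longleftrightarrow> (i + j) mod 3 = 0" "3 dvd m \<longleftrightarrow> i = 0" "3 dvd n \<longleftrightarrow> j = 0"
      unfolding i j by (simp_all add: mod_add_eq dvd_eq_mod_eq_0)
    moreover have "i < 3" "j < 3" by (simp_all add: i j)
    then have "i = 0 \<or> i = 1 \<or> i = 2" "j = 0 \<or> j = 1 \<or> j = 2" by auto
    ultimately show ?thesis unfolding coprime3_def by (elim disjE) simp_all
  qed
  have s: "((\<lambda>(m, n). of_nat m * of_nat n * (coprime3 (m - n + (n - m)) + coprime3 (m + n))
          * (lambert_coeff q m * lambert_coeff q n)) has_sum ?s) ({1..} \<times> {1..})"
    unfolding f
    by (rule has_sum_cong[THEN iffD1, OF _ has_sum_subtract[OF has_sum_add[OF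
          has_sum_cmult_right[OF P1, of 2] has_sum_cmult_right[OF P2, of 2]]
          has_sum_cmult_right[OF P3, of 3]]]) (auto simp: algebra_simps)
  have "((\<lambda>k. (of_nat k)\<^sup>2 * coprime3 0 * (lambert_coeff q k)\<^sup>2 + lambert_coeff q k *
       (coprime3 k * (\<Sum>l\<in>{1..<k}. of_nat l * (of_nat k - of_nat l))
            - 2 * of_nat k * (\<Sum>l\<in>{1..<k}. (of_nat k - of_nat l) * coprime3 l)))
       has_sum (?s - 4 * (K 1 * lambert 1 q))) {1..}"
    by (rule lambert_weighted_identity[OF q _ s P1, where p = 0]) (simp add: norm_coprime3_le)
  moreover have "((\<lambda>k. 1/6 * (coprime3 k * (of_nat k ^ 3 * lambert_coeff q k))
        + 1/2 * (coprime3 k * (of_nat k ^ 1 * lambert_coeff q k)) - 2/3 * (of_nat k ^ 3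
        * lambert_coeff q k))
      has_sum (1/6 * K 3 + 1/2 * K 1 - 2/3 * lambert 3 q)) {1..}"
    by (intro has_sum_subtract has_sum_add has_sum_cmult_right K lambert_has_sum(1)[OF q])
  ultimately have "?s - 4 * (K 1 * lambert 1 q) = 1/6 * K 3 + 1/2 * K 1 - 2/3 * lambert 3 q"
    by (rule has_sum_eq_of_cong)
       (unfold sum_times_diff_below sum_diff_coprime3, auto simp: field_simps eval_nat_numeral)
  then show ?thesis by (simp add: algebra_simps)
qed

subsection \<open>Derivatives on the upper half plane\<close>

lemma norm_nome: "norm (nome \<tau>) = exp (- (2 * pi * Im \<tau>))"
  by (simp add: nome_def norm_exp_eq_Re)

lemma norm_nome_less_1: "Im \<tau> > 0 \<Longrightarrow> norm (nome \<tau>) < 1"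
  by (simp add: norm_nome)

lemma nome_triple: "nome (3 * \<tau>) = nome \<tau> ^ 3"
  by (simp add: nome_def exp_of_nat_mult[symmetric] mult_ac)

lemma nome_has_field_derivative [derivative_intros]:
  "(nome has_field_derivative 2 * of_real pi * \<i> * nome \<tau>) (at \<tau> within A)"
  unfolding nome_def [abs_def] by (auto intro!: derivative_eq_intros)

lemma lambert_coeff_nome_has_field_derivative:
  assumes "Im \<tau> > 0" "n \<ge> 1"
  shows "((\<lambda>\<tau>. lambert_coeff (nome \<tau>) n) has_field_derivative
    2 * of_real pi * \<i> * (of_nat n * (lambert_coeff (nome \<tau>) n + (lambert_coeff (nome \<tau>) n)\<^sup>2)))
      (at \<tau> within A)"
proof -
  have nz: "1 - nome \<tau> ^ n \<noteq> 0"
    using assms by (intro one_minus_power_nonzero norm_nome_less_1) auto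
  have pow: "nome \<tau> ^ (n - Suc 0) * nome \<tau> = nome \<tau> ^ n"
    using assms(2) by (cases n) auto
  have "((\<lambda>\<tau>. nome \<tau> ^ n) has_field_derivative 2 * of_real pi * \<i> * of_nat n
      * nome \<tau> ^ n) (at \<tau> within A)"
    by (rule derivative_eq_intros nome_has_field_derivative refl)+ (use pow in \<open>simp add: mult_ac\<close>)
  from DERIV_divide[OF this DERIV_diff[OF DERIV_const this] nz]
  show ?thesis
    unfolding lambert_coeff_def
    by (rule DERIV_cong) (use nz in \<open>simp add: divide_simps power2_eq_square, simp add:
        algebra_simps\<close>)
qed

lemma has_sum_atLeast1_sums:
  fixes f :: "nat \<Rightarrow> complex"
  assumes "(f has_sum s) {1..}"
  shows "(\<lambda>n. f (Suc n)) sums s"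
proof (rule has_sum_imp_sums)
  show "((\<lambda>n. f (Suc n)) has_sum s) UNIV"
    using assms by (rule has_sum_reindex_bij_witness[where j = "\<lambda>n. n - 1" and i = Suc,
        THEN iffD1, OF _ _ _ _ _ refl, rotated -1]) auto
qed

lemma lambert_sums:
  assumes "norm q < 1"
  shows "(\<lambda>n. of_nat (Suc n) ^ p * lambert_coeff q (Suc n)) sums lambert p q"
    and "(\<lambda>n. of_nat (Suc n) ^ p * (lambert_coeff q (Suc n))\<^sup>2) sums lambert_sq p q"
  using has_sum_atLeast1_sums[OF lambert_has_sum(1)[OF assms]]
    has_sum_atLeast1_sums[OF lambert_has_sum(2)[OF assms]] by auto

text \<open>The general combination with \<open>a\<close>, \<open>b\<close>, \<open>c\<close> covers
  both uses: \<open>a = b = 1\<close> for derivatives of Lambert series, and \<open>a = 1\<close>,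
  \<open>b = 0\<close> for the logarithm of the eta product.\<close>

lemma lambert_coeff_nome_uniformly_convergent:
  assumes "y > 0"
  shows "uniformly_convergent_on {z. Im z > y} (\<lambda>n z. \<Sum>i<n. c * (of_nat (Suc i) ^ p *
           (a * lambert_coeff (nome z) (Suc i) + b * (lambert_coeff (nome z) (Suc i))\<^sup>2)))"
proof -
  define r where "r = exp (- (2 * pi * y))"
  have r: "0 < r" "r < 1" using assms by (auto simp: r_def)
  have "summable (\<lambda>n. norm c * (norm a / (1 - r) + norm b / (1 - r)\<^sup>2) * (real (Suc n) ^ p
      * r ^ Suc n))"
    using summable_power_times_geometric[of r p] r
    by (intro summable_mult) (subst summable_Suc_iff, auto)
  then show ?thesis
  proof (rule Weierstrass_m_test'[rotated])
    fix n :: nat and z assume "z \<in> {z. Im z > y}"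
    then have "norm (nome z) \<le> r" by (simp add: norm_nome r_def)
    then have u: "norm (lambert_coeff (nome z) (Suc n)) \<le> r ^ Suc n / (1 - r)"
      using r by (intro norm_lambert_coeff_le) auto
    have "r ^ Suc n \<le> 1" using r by (intro power_le_one) auto
    then have "r ^ Suc n / (1 - r) \<le> 1 / (1 - r)" using r by (intro divide_right_mono) auto
    then have "norm (lambert_coeff (nome z) (Suc n)) ^ 2 \<le> (r ^ Suc n / (1 - r)) * (1 / (1 - r))"
      unfolding power2_eq_square using u r by (intro mult_mono) auto
    then have u2: "norm (lambert_coeff (nome z) (Suc n)) ^ 2 \<le> r ^ Suc n / (1 - r)\<^sup>2"
      by (simp add: power2_eq_square)
    have "norm (a * lambert_coeff (nome z) (Suc n) + b * (lambert_coeff (nome z) (Suc n))\<^sup>2)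
        \<le> norm a * (r ^ Suc n / (1 - r)) + norm b * (r ^ Suc n / (1 - r)\<^sup>2)"
      using mult_left_mono[OF u, of "norm a"] mult_left_mono[OF u2, of "norm b"]
      by (intro norm_triangle_le add_mono) (simp_all add: norm_mult norm_power del: power_Suc)
    then have "norm c * real (Suc n) ^ p * norm (a * lambert_coeff (nome z) (Suc n)
          + b * (lambert_coeff (nome z) (Suc n))\<^sup>2)
        \<le> norm c * real (Suc n) ^ p * (norm a * (r ^ Suc n / (1 - r)) + norm b * (r ^ Suc n / (1
        - r)\<^sup>2))"
      by (intro mult_left_mono) auto
    also have "\<dots> = norm c * (norm a / (1 - r) + norm b / (1 - r)\<^sup>2) * (real (Suc n) ^ p
        * r ^ Suc n)"
      by (simp add: algebra_simps)
    finally show "norm (c * (of_nat (Suc n) ^ p *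
           (a * lambert_coeff (nome z) (Suc n) + b * (lambert_coeff (nome z) (Suc n))\<^sup>2)))
        \<le> norm c * (norm a / (1 - r) + norm b / (1 - r)\<^sup>2) * (real (Suc n) ^ p * r ^ Suc n)"
      by (simp add: norm_mult norm_power mult.assoc del: of_nat_Suc power_Suc)
  qed
qed

lemma upper_half_series_has_field_derivative:
  assumes \<tau>: "Im \<tau> > 0"
    and deriv: "\<And>n z. Im z > 0 \<Longrightarrow> (f n has_field_derivative c * (of_nat (Suc n) ^ p *
       (a * lambert_coeff (nome z) (Suc n) + b * (lambert_coeff (nome z) (Suc n))\<^sup>2))) (at z)"
    and summable: "summable (\<lambda>n. f n \<tau>)"
  shows "((\<lambda>z. \<Sum>n. f n z) has_field_derivative
           c * (a * lambert p (nome \<tau>) + b * lambert_sq p (nome \<tau>))) (at \<tau>)"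
proof -
  \<comment> \<open>The M-test needs a half plane at positive distance from the real axis; this one
    contains \<tau> in its interior.\<close>
  let ?S = "{z. Im z > Im \<tau> / 2}"
  have int: "\<tau> \<in> interior ?S"
    using \<tau> by (simp only: interior_open[OF open_halfspace_Im_gt]) simp
  have "((\<lambda>z. \<Sum>n. f n z) has_field_derivative (\<Sum>n. c * (of_nat (Suc n) ^ p *
       (a * lambert_coeff (nome \<tau>) (Suc n) + b * (lambert_coeff (nome \<tau>) (Suc n))\<^sup>2)))) (at \<tau>)"
  proof (rule has_field_derivative_series'(2)[where S = ?S and f = f and ?x0.0
      = \<tau>, OF _ _ _ _ summable int])
    show "convex ?S" by (rule convex_halfspace_Im_gt)
    show "(f n has_field_derivative c * (of_nat (Suc n) ^ p *
       (a * lambert_coeff (nome z) (Suc n) + b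
       * (lambert_coeff (nome z) (Suc n))\<^sup>2))) (at z within ?S)"
      if "z \<in> ?S" for n z
      by (rule has_field_derivative_at_within, rule deriv) (use that \<tau> in auto)
    show "uniformly_convergent_on ?S (\<lambda>n z. \<Sum>i<n. c * (of_nat (Suc i) ^ p *
           (a * lambert_coeff (nome z) (Suc i) + b * (lambert_coeff (nome z) (Suc i))\<^sup>2)))"
      using \<tau> by (intro lambert_coeff_nome_uniformly_convergent) auto
  qed (use \<tau> in auto)
  moreover have "(\<lambda>n. c * (of_nat (Suc n) ^ p *
       (a * lambert_coeff (nome \<tau>) (Suc n) + b * (lambert_coeff (nome \<tau>) (Suc n))\<^sup>2)))
      sums (c * (a * lambert p (nome \<tau>) + b * lambert_sq p (nome \<tau>)))"
    using sums_mult[OF sums_add[OF sums_mult[OF lambert_sums(1)[OF norm_nome_less_1[OF \<tau>], of p],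
        of a]
        sums_mult[OF lambert_sums(2)[OF norm_nome_less_1[OF \<tau>], of p], of b]], of c]
    by (simp add: algebra_simps)
  ultimately show ?thesis by (simp add: sums_iff)
qed

text \<open>The closed forms agree only on the upper half plane; since it is open, derivatives carry
  over.\<close>

lemma has_field_derivative_upper_half_cong:
  assumes "(f has_field_derivative D) (at \<tau>)" "Im \<tau> > 0" "\<And>z. Im z > 0 \<Longrightarrow> f z = g z"
  shows "(g has_field_derivative D) (at \<tau>)"
  by (rule has_field_derivative_transform_within_open[OF assms(1) open_halfspace_Im_gt[of 0]])
     (use assms in auto)

lemma lambert_nome_has_field_derivative:
  assumes \<tau>: "Im \<tau> > 0"
  shows "((\<lambda>\<tau>. lambert p (nome \<tau>)) has_field_derivative
           2 * of_real pi * \<i> * (lambert (Suc p) (nome \<tau>) + lambert_sq (Suc p) (nome \<tau>))) (at \<tau>)"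
proof -
  have "((\<lambda>z. \<Sum>n. of_nat (Suc n) ^ p * lambert_coeff (nome z) (Suc n)) has_field_derivative
      2 * of_real pi * \<i> * (1 * lambert (Suc p) (nome \<tau>) + 1 * lambert_sq (Suc p) (nome \<tau>))) (at \<tau>)"
  proof (rule upper_half_series_has_field_derivative[OF \<tau>])
    fix n z assume z: "Im z > 0"
    show "((\<lambda>z. of_nat (Suc n) ^ p * lambert_coeff (nome z) (Suc n)) has_field_derivative
      2 * of_real pi * \<i> * (of_nat (Suc n) ^ Suc p *
        (1 * lambert_coeff (nome z) (Suc n) + 1 * (lambert_coeff (nome z) (Suc n))\<^sup>2))) (at z)"
      by (rule DERIV_cong[OF DERIV_cmult[OF lambert_coeff_nome_has_field_derivative[OF z]]])
         (auto simp: mult_ac)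
  qed (rule sums_summable[OF lambert_sums(1)[OF norm_nome_less_1[OF \<tau>]]])
  then show ?thesis
    by (rule has_field_derivative_upper_half_cong[OF DERIV_cong \<tau>])
       (simp_all add: sums_unique[OF lambert_sums(1)[OF norm_nome_less_1]])
qed

section \<open>Ramanujan's differential equations\<close>

lemma Eisenstein_eq_lambert:
  assumes "Im \<tau> > 0"
  shows "E2 \<tau> = 1 - 24 * lambert 1 (nome \<tau>)"
    and "E4 \<tau> = 1 + 240 * lambert 3 (nome \<tau>)"
    and "E6 \<tau> = 1 - 504 * lambert 5 (nome \<tau>)"
  using lambert_sums(1)[OF norm_nome_less_1[OF assms], of 1]
    lambert_sums(1)[OF norm_nome_less_1[OF assms], of 3]
    lambert_sums(1)[OF norm_nome_less_1[OF assms], of 5]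
  by (simp_all add: E2_def E4_def E6_def lambert_coeff_def sums_iff)

lemma Ramanujan_E2:
  assumes \<tau>: "Im \<tau> > 0"
  shows "(E2 has_field_derivative 2 * of_real pi * \<i> * ((E2 \<tau> ^ 2 - E4 \<tau>) / 12)) (at \<tau>)"
proof -
  \<comment> \<open>The left side is twice q d/dq of \<open>lambert 1\<close>; the convolution
    identity frees it of \<open>lambert_sq\<close>.\<close>
  have "2 * (lambert 2 (nome \<tau>) + lambert_sq 2 (nome \<tau>))
      = 5/3 * lambert 3 (nome \<tau>) + 1/3 * lambert 1 (nome \<tau>) - 4 * lambert 1 (nome \<tau>)
      * lambert 1 (nome \<tau>)"
    using lambert_convolution_1_1[OF norm_nome_less_1[OF \<tau>]] by (simp add: algebra_simps)
  then have "- 24 * (lambert 2 (nome \<tau>) + lambert_sq 2 (nome \<tau>)) = (E2 \<tau> ^ 2 - E4 \<tau>) / 12"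
    unfolding Eisenstein_eq_lambert[OF \<tau>] by algebra
  moreover have "((\<lambda>\<tau>. 1 - 24 * lambert 1 (nome \<tau>)) has_field_derivative
      - (24 * (2 * of_real pi * \<i> * (lambert (Suc 1) (nome \<tau>)
      + lambert_sq (Suc 1) (nome \<tau>))))) (at \<tau>)"
    by (rule DERIV_cong[OF DERIV_diff[OF DERIV_const DERIV_cmult[OF
        lambert_nome_has_field_derivative[OF \<tau>]]]]) simp
  ultimately have "((\<lambda>\<tau>. 1 - 24 * lambert 1 (nome \<tau>)) has_field_derivative
      2 * of_real pi * \<i> * ((E2 \<tau> ^ 2 - E4 \<tau>) / 12)) (at \<tau>)"
    by (elim DERIV_cong) (simp add: eval_nat_numeral algebra_simps)
  then show ?thesis
    by (rule has_field_derivative_upper_half_cong[OF _ \<tau>]) (simp add: Eisenstein_eq_lambert)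
qed

lemma Ramanujan_E4:
  assumes \<tau>: "Im \<tau> > 0"
  shows "(E4 has_field_derivative 2 * of_real pi * \<i> * ((E2 \<tau> * E4 \<tau> - E6 \<tau>) / 3)) (at \<tau>)"
proof -
  have "2 * (lambert 4 (nome \<tau>) + lambert_sq 4 (nome \<tau>))
      = 7/5 * lambert 5 (nome \<tau>) + 2/3 * lambert 3 (nome \<tau>) - 1/15 * lambert 1 (nome \<tau>)
        - 16 * lambert 1 (nome \<tau>) * lambert 3 (nome \<tau>)"
    using lambert_convolution_1_3[OF norm_nome_less_1[OF \<tau>]] by (simp add: algebra_simps)
  then have eq: "240 * (lambert 4 (nome \<tau>) + lambert_sq 4 (nome \<tau>)) = (E2 \<tau> * E4 \<tau> - E6 \<tau>) / 3"
    unfolding Eisenstein_eq_lambert[OF \<tau>] by algebra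
  have "((\<lambda>\<tau>. 1 + 240 * lambert 3 (nome \<tau>)) has_field_derivative
      240 * (2 * of_real pi * \<i> * (lambert (Suc 3) (nome \<tau>) + lambert_sq (Suc 3) (nome \<tau>)))) (at \<tau>)"
    by (rule DERIV_cong[OF DERIV_add[OF DERIV_const DERIV_cmult[OF
        lambert_nome_has_field_derivative[OF \<tau>]]]]) simp
  then have "((\<lambda>\<tau>. 1 + 240 * lambert 3 (nome \<tau>)) has_field_derivative
      2 * of_real pi * \<i> * ((E2 \<tau> * E4 \<tau> - E6 \<tau>) / 3)) (at \<tau>)"
    by (rule DERIV_cong) (simp add: algebra_simps flip: eq)
  then show ?thesis
    by (rule has_field_derivative_upper_half_cong[OF _ \<tau>]) (simp add: Eisenstein_eq_lambert)
qed

lemma Ramanujan_E6: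
  assumes \<tau>: "Im \<tau> > 0"
  shows "(E6 has_field_derivative 2 * of_real pi * \<i> * ((E2 \<tau> * E6 \<tau> - E4 \<tau> ^ 2) / 2)) (at \<tau>)"
proof -
  have "2 * (lambert 6 (nome \<tau>) + lambert_sq 6 (nome \<tau>))
      = 9/7 * lambert 7 (nome \<tau>) + lambert 5 (nome \<tau>) - 1/3 * lambert 3 (nome \<tau>) + 1/21
      * lambert 1 (nome \<tau>)
        - 24 * lambert 1 (nome \<tau>) * lambert 5 (nome \<tau>) - 40 * lambert 3 (nome \<tau>)
        * lambert 3 (nome \<tau>)"
    using lambert_convolution_1_5[OF norm_nome_less_1[OF \<tau>]] by (simp add: algebra_simps)
  \<comment> \<open>The relation E4^2 = E8 replaces \<open>lambert 7\<close>, so that only E2, E4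
    and E6 remain.\<close>
  moreover have "lambert 7 (nome \<tau>) = 120 * lambert 3 (nome \<tau>) * lambert 3 (nome \<tau>)
      + lambert 3 (nome \<tau>)"
    using lambert_convolution_3_3[OF norm_nome_less_1[OF \<tau>]] by (simp add: field_simps)
  ultimately have eq: "- 504 * (lambert 6 (nome \<tau>) + lambert_sq 6 (nome \<tau>)) = (E2 \<tau> * E6 \<tau>
      - E4 \<tau> ^ 2) / 2"
    unfolding Eisenstein_eq_lambert[OF \<tau>] by algebra
  have "((\<lambda>\<tau>. 1 - 504 * lambert 5 (nome \<tau>)) has_field_derivative
      - (504 * (2 * of_real pi * \<i> * (lambert (Suc 5) (nome \<tau>)
      + lambert_sq (Suc 5) (nome \<tau>))))) (at \<tau>)"
    by (rule DERIV_cong[OF DERIV_diff[OF DERIV_const DERIV_cmult[OF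
        lambert_nome_has_field_derivative[OF \<tau>]]]]) simp
  then have "((\<lambda>\<tau>. 1 - 504 * lambert 5 (nome \<tau>)) has_field_derivative
      2 * of_real pi * \<i> * ((E2 \<tau> * E6 \<tau> - E4 \<tau> ^ 2) / 2)) (at \<tau>)"
    by (rule DERIV_cong) (simp add: algebra_simps flip: eq)
  then show ?thesis
    by (rule has_field_derivative_upper_half_cong[OF _ \<tau>]) (simp add: Eisenstein_eq_lambert)
qed

section \<open>The weight 2 Eisenstein series of level 3\<close>

definition level3_E2 :: "complex \<Rightarrow> complex" where
  "level3_E2 \<tau> = (3 * E2 (3 * \<tau>) - E2 \<tau>) / 2"

text \<open>In the notation of \<open>lambert_convolution_coprime3\<close>, \<open>level3_E2\<close>
  is \<open>1 + 12 * K 1\<close>, and the right side is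
  \<open>10 + 320 * lambert 3 q - 80 * K 3\<close>; the claim is that convolution up to
  scaling.\<close>

lemma level3_E2_square:
  assumes \<tau>: "Im \<tau> > 0"
  shows "10 * level3_E2 \<tau> ^ 2 = 9 * E4 (3 * \<tau>) + E4 \<tau>"
proof -
  have \<tau>3: "Im (3 * \<tau>) > 0" using \<tau> by simp
  show ?thesis
    using lambert_convolution_coprime3[OF norm_nome_less_1[OF \<tau>]]
    unfolding level3_E2_def Eisenstein_eq_lambert[OF \<tau>] Eisenstein_eq_lambert[OF \<tau>3] nome_triple
    by simp algebra
qed

lemma level3_E2_has_field_derivative:
  assumes \<tau>: "Im \<tau> > 0"
  shows "(level3_E2 has_field_derivative 2 * of_real pi * \<i> *
           ((2 * level3_E2 \<tau> * E2 \<tau> - 3 * level3_E2 \<tau> ^ 2 + E4 \<tau>) / 12)) (at \<tau>)"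
proof -
  have \<tau>3: "Im (3 * \<tau>) > 0" using \<tau> by simp
  have "((\<lambda>\<tau>. E2 (3 * \<tau>)) has_field_derivative
      (2 * of_real pi * \<i> * ((E2 (3 * \<tau>) ^ 2 - E4 (3 * \<tau>)) / 12)) * 3) (at \<tau>)"
    by (rule DERIV_chain2[where g = "\<lambda>\<tau>. 3
        * \<tau>", OF Ramanujan_E2[OF \<tau>3]]) (auto intro!: derivative_eq_intros)
  then have d: "(level3_E2 has_field_derivative
      (3 * ((2 * of_real pi * \<i> * ((E2 (3 * \<tau>) ^ 2 - E4 (3 * \<tau>)) / 12)) * 3)
        - 2 * of_real pi * \<i> * ((E2 \<tau> ^ 2 - E4 \<tau>) / 12)) / 2) (at \<tau>)"
    unfolding level3_E2_def [abs_def]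
    by (intro DERIV_cdivide DERIV_diff DERIV_cmult Ramanujan_E2[OF \<tau>])
  \<comment> \<open>Both values at 3\<tau> are eliminated: 3 E2(3\<tau>) = 2M + P, and 9 E4(3\<tau>)
    = 10 M^2 - E4.\<close>
  have "9 * (E2 (3 * \<tau>) ^ 2 - E4 (3 * \<tau>))
      = E2 \<tau> ^ 2 - E4 \<tau> + 2 * (2 * level3_E2 \<tau> * E2 \<tau> - 3 * level3_E2 \<tau> ^ 2 + E4 \<tau>)"
  proof -
    have "3 * E2 (3 * \<tau>) = 2 * level3_E2 \<tau> + E2 \<tau>" by (simp add: level3_E2_def field_simps)
    with level3_E2_square[OF \<tau>] show ?thesis by algebra
  qed
  then have eq: "E2 (3 * \<tau>) ^ 2 - E4 (3 * \<tau>)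
      = (E2 \<tau> ^ 2 - E4 \<tau> + 2 * (2 * level3_E2 \<tau> * E2 \<tau> - 3 * level3_E2 \<tau> ^ 2 + E4 \<tau>)) / 9"
    by (subst eq_divide_eq) (simp add: mult.commute)
  show ?thesis
    by (rule DERIV_cong[OF d[unfolded eq]]) (simp add: field_simps)
qed

section \<open>Logarithmic derivatives of eta and the eta quotient\<close>

lemma dedekind_eta_eq_exp:
  assumes \<tau>: "Im \<tau> > 0"
  shows "summable (\<lambda>n. Ln (1 - nome \<tau> ^ Suc n))"
    and "dedekind_eta \<tau> = exp (2 * of_real pi * \<i> * \<tau> / 24 + (\<Sum>n. Ln (1 - nome \<tau> ^ Suc n)))"
proof -
  let ?r = "norm (nome \<tau>)"
  have r: "?r < 1" by (rule norm_nome_less_1[OF \<tau>])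
  have "(\<lambda>n. ?r ^ Suc n) \<longlonglongrightarrow> 0"
    using LIMSEQ_power_zero[of ?r] r by (intro LIMSEQ_Suc) auto
  then have "eventually (\<lambda>n. ?r ^ Suc n < 1/2) sequentially"
    by (rule order_tendstoD) simp
  then have "eventually (\<lambda>n. norm (Ln (1 - nome \<tau> ^ Suc n)) \<le> 2 * ?r ^ Suc n) sequentially"
  proof eventually_elim
    case (elim n)
    then show ?case using norm_Ln_le[of "- (nome \<tau> ^ Suc n)"] by (simp add: norm_power norm_mult)
  qed
  moreover have "summable (\<lambda>n. 2 * ?r ^ Suc n)"
    using r by (intro summable_mult) (subst summable_Suc_iff, simp add: summable_geometric)
  ultimately show summable: "summable (\<lambda>n. Ln (1 - nome \<tau> ^ Suc n))"
    by (rule summable_comparison_test_ev)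
  \<comment> \<open>The principal logarithms of the factors add up to some logarithm of the product.
    Exponentiation removes the choice of branch, and the resulting series can be differentiated
    termwise.\<close>
  have "1 - nome \<tau> ^ Suc n \<noteq> 0" for n
    using r by (intro one_minus_power_nonzero) auto
  then have "(\<Prod>n. 1 - nome \<tau> ^ Suc n) = (\<Prod>n. exp (Ln (1 - nome \<tau> ^ Suc n)))"
    by (intro prodinf_cong exp_Ln[symmetric])
  also have "\<dots> = exp (\<Sum>n. Ln (1 - nome \<tau> ^ Suc n))"
    by (rule prodinf_exp[OF summable])
  finally show "dedekind_eta \<tau> = exp (2 * of_real pi * \<i> * \<tau> / 24 + (\<Sum>n. Ln (1 - nome \<tau> ^ Suc n)))"
    by (simp add: dedekind_eta_def exp_add)
qed

lemma dedekind_eta_nonzero: "Im \<tau> > 0 \<Longrightarrow> dedekind_eta \<tau> \<noteq> 0"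
  by (simp add: dedekind_eta_eq_exp(2))

text \<open>The logarithmic q d/dq derivative is 1/24 from the prefactor minus
  \<open>lambert 1\<close> from the product, which is E2/24.\<close>

lemma dedekind_eta_has_field_derivative:
  assumes \<tau>: "Im \<tau> > 0"
  shows "(dedekind_eta has_field_derivative 2 * of_real pi * \<i> * (E2 \<tau> / 24
      * dedekind_eta \<tau>)) (at \<tau>)"
proof -
  let ?L = "\<lambda>z. \<Sum>n. Ln (1 - nome z ^ Suc n)"
  have "(?L has_field_derivative - (2 * of_real pi * \<i>) * (1 * lambert 1 (nome \<tau>) + 0
      * lambert_sq 1 (nome \<tau>))) (at \<tau>)"
  proof (rule upper_half_series_has_field_derivative[where f = "\<lambda>n z. Ln (1
      - nome z ^ Suc n)", OF \<tau> _ dedekind_eta_eq_exp(1)[OF \<tau>]])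
    fix n z assume z: "Im z > 0"
    have "nome z \<noteq> 0" by (simp add: nome_def)
    then have "norm (nome z ^ Suc n) < 1"
      unfolding norm_power using norm_nome_less_1[OF z] by (intro power_Suc_less_one) auto
    \<comment> \<open>Each factor has positive real part and so stays off the branch cut of
      \<open>Ln\<close>.\<close>
    then have "Re (nome z ^ Suc n) < 1" using complex_Re_le_cmod[of "nome z ^ Suc n"] by linarith
    then have pos: "1 - nome z ^ Suc n \<notin> \<real>\<^sub>\<le>\<^sub>0" by (auto simp: complex_nonpos_Reals_iff)
    have "((\<lambda>z. nome z ^ Suc n) has_field_derivative of_nat (Suc n) * (2 * of_real pi * \<i>
        * nome z) * nome z ^ n) (at z)"
      by (rule DERIV_cong[OF DERIV_power_Suc[OF nome_has_field_derivative]]) simp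
    from DERIV_chain2[OF has_field_derivative_Ln[OF pos] DERIV_diff[OF DERIV_const this]]
    show "((\<lambda>z. Ln (1 - nome z ^ Suc n)) has_field_derivative
      - (2 * of_real pi * \<i>) * (of_nat (Suc n) ^ 1 * (1 * lambert_coeff (nome z) (Suc n)
         + 0 * (lambert_coeff (nome z) (Suc n))\<^sup>2))) (at z)"
      by (elim DERIV_cong) (simp add: lambert_coeff_def field_simps)
  qed
  then have "((\<lambda>z. exp (2 * of_real pi * \<i> * z / 24 + ?L z)) has_field_derivative
      exp (2 * of_real pi * \<i> * \<tau> / 24 + ?L \<tau>) *
       (2 * of_real pi * \<i> / 24 + - (2 * of_real pi * \<i>) * (1 * lambert 1 (nome \<tau>) + 0
       * lambert_sq 1 (nome \<tau>)))) (at \<tau>)"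
    by (intro DERIV_chain2[OF DERIV_exp] DERIV_add) (auto intro!: derivative_eq_intros)
  then have "((\<lambda>z. exp (2 * of_real pi * \<i> * z / 24 + ?L z)) has_field_derivative
      2 * of_real pi * \<i> * (E2 \<tau> / 24 * dedekind_eta \<tau>)) (at \<tau>)"
    by (elim DERIV_cong) (simp add: dedekind_eta_eq_exp(2)[OF \<tau>] Eisenstein_eq_lambert[OF \<tau>]
        field_simps)
  then show ?thesis
    by (rule has_field_derivative_upper_half_cong[OF _ \<tau>]) (simp add: dedekind_eta_eq_exp(2))
qed

definition eta_quotient :: "complex \<Rightarrow> complex" where
  "eta_quotient \<tau> = dedekind_eta (3 * \<tau>) ^ 3 / dedekind_eta \<tau> ^ 5"

text \<open>The logarithmic q d/dq derivative is (9 E2(3\<tau>) - 5 E2(\<tau>))/24; substitute 3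
  E2(3\<tau>) = 2M + P.\<close>

lemma eta_quotient_has_field_derivative:
  assumes \<tau>: "Im \<tau> > 0"
  shows "(eta_quotient has_field_derivative
           2 * of_real pi * \<i> * ((level3_E2 \<tau> / 4 - E2 \<tau> / 12) * eta_quotient \<tau>)) (at \<tau>)"
proof -
  have \<tau>3: "Im (3 * \<tau>) > 0" using \<tau> by simp
  have d3: "((\<lambda>\<tau>. dedekind_eta (3 * \<tau>)) has_field_derivative
      (2 * of_real pi * \<i> * (E2 (3 * \<tau>) / 24 * dedekind_eta (3 * \<tau>))) * 3) (at \<tau>)"
    by (rule DERIV_chain2[where g = "\<lambda>\<tau>. 3
        * \<tau>", OF dedekind_eta_has_field_derivative[OF \<tau>3]]) (auto intro!: derivative_eq_intros)
  show ?thesis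
    unfolding eta_quotient_def [abs_def]
    by (rule derivative_eq_intros d3 dedekind_eta_has_field_derivative[OF \<tau>] refl)+
       (use dedekind_eta_nonzero[OF \<tau>] in \<open>simp_all add: level3_E2_def field_simps
       eval_nat_numeral\<close>)
qed

section \<open>Iterated Serre derivatives of the supercharacter\<close>

lemma serre_deriv_eq:
  assumes "\<And>z. Im z > 0 \<Longrightarrow> f z = g z" "Im \<tau> > 0"
    and "(g has_field_derivative 2 * of_real pi * \<i> * d) (at \<tau>)"
  shows "serre_deriv k f \<tau> = d - of_nat k / 12 * E2 \<tau> * g \<tau>"
proof -
  have "(f has_field_derivative 2 * of_real pi * \<i> * d) (at \<tau>)"
    by (rule has_field_derivative_upper_half_cong[OF assms(3,2)]) (simp add: assms(1))
  then have "deriv f \<tau> = 2 * of_real pi * \<i> * d" by (rule DERIV_imp_deriv)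
  then show ?thesis using assms by (simp add: serre_deriv_def q_deriv_def)
qed

text \<open>One step of the recursion on the pair \<open>A\<close>, \<open>B\<close>. In each
  application \<open>A\<close> has weight \<open>k\<close>, which makes the terms in E2^2 cancel.
  The term -M^2/4 in DM cancels against M/4 from the eta quotient, so \<open>A\<close> and
  \<open>B\<close> stay at most linear in M.\<close>

lemma serre_deriv_quasimodular_eq:
  assumes f: "\<And>z. Im z > 0 \<Longrightarrow> f z = (E2 z * A z + B z) * eta_quotient z"
    and \<tau>: "Im \<tau> > 0"
    and A: "(A has_field_derivative 2 * of_real pi * \<i> * a) (at \<tau>)"
    and B: "(B has_field_derivative 2 * of_real pi * \<i> * b) (at \<tau>)"
  shows "serre_deriv k f \<tau> = ((E2 \<tau> ^ 2 - E4 \<tau>) / 12 * A \<tau> + E2 \<tau> * a + b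
    + (level3_E2 \<tau> / 4 - E2 \<tau> / 12 - of_nat k / 12 * E2 \<tau>) * (E2 \<tau> * A \<tau> + B \<tau>)) * eta_quotient \<tau>"
proof -
  have "((\<lambda>z. (E2 z * A z + B z) * eta_quotient z) has_field_derivative 2 * of_real pi * \<i> *
     (((E2 \<tau> ^ 2 - E4 \<tau>) / 12 * A \<tau> + E2 \<tau> * a + b) * eta_quotient \<tau>
       + (E2 \<tau> * A \<tau> + B \<tau>) * ((level3_E2 \<tau> / 4 - E2 \<tau> / 12) * eta_quotient \<tau>))) (at \<tau>)"
    by (rule DERIV_cong[OF DERIV_mult[OF DERIV_add[OF DERIV_mult[OF Ramanujan_E2[OF \<tau>] A] B]
          eta_quotient_has_field_derivative[OF \<tau>]]]) (simp add: field_simps)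
  from serre_deriv_eq[of f, OF f \<tau> this] show ?thesis
    by (rule trans) (simp_all add: field_simps)
qed

text \<open>Start of the recursion, with \<open>A\<close> constant and \<open>B\<close> a multiple
  of M, by 3 E2(3\<tau>) = 2M + P.\<close>

lemma sch_U_eq:
  "sch_U \<tau> = (E2 \<tau> * (1/4) + 3/4 * level3_E2 \<tau>) * eta_quotient \<tau>"
proof -
  have "- (1 / 8) * (E2 \<tau> - 9 * E2 (3 * \<tau>)) = E2 \<tau> * (1/4) + 3/4 * level3_E2 \<tau>"
    by (simp add: level3_E2_def field_simps)
  then show ?thesis by (simp add: sch_U_def eta_quotient_def)
qed

text \<open>Here and in the next four lemmas the middle expression is the direct output of
  \<open>serre_deriv_quasimodular_eq\<close>, with the derivatives of \<open>A\<close> and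
  \<open>B\<close> written out; the last one collects the new pair.\<close>

lemma serre_deriv_iter_1:
  assumes "Im \<tau> > 0"
  shows "serre_deriv_iter 1 sch_U \<tau> = (E2 \<tau> * (1/8 * level3_E2 \<tau>) + 1/24 * E4 \<tau>) * eta_quotient \<tau>"
proof -
  note [derivative_intros] = level3_E2_has_field_derivative[OF assms]
    Ramanujan_E4[OF assms] Ramanujan_E6[OF assms]
  have "serre_deriv_iter 1 sch_U \<tau> = serre_deriv 0 sch_U \<tau>"
    by (simp add: eval_nat_numeral)
  also have "\<dots> = ((E2 \<tau> ^ 2 - E4 \<tau>) / 12 * (1/4) + E2 \<tau> * (0) + 3/4 * ((2 * level3_E2 \<tau> * E2 \<tau> - 3
      * level3_E2 \<tau> ^ 2 + E4 \<tau>) / 12)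
      + (level3_E2 \<tau> / 4 - E2 \<tau> / 12 - of_nat 0 / 12 * E2 \<tau>) * (E2 \<tau> * (1/4) + 3/4 * level3_E2 \<tau>))
      * eta_quotient \<tau>"
    by (rule serre_deriv_quasimodular_eq[OF sch_U_eq assms])
      (auto intro!: derivative_eq_intros simp: field_simps eval_nat_numeral)
  also have "\<dots> = (E2 \<tau> * (1/8 * level3_E2 \<tau>) + 1/24 * E4 \<tau>) * eta_quotient \<tau>"
    by (simp add: field_simps eval_nat_numeral)
  finally show ?thesis .
qed

text \<open>At this stage M drops out: the result is q d/dq of E4, times the eta quotient, divided
  by 24.\<close>

lemma serre_deriv_iter_2:
  assumes "Im \<tau> > 0"
  shows "serre_deriv_iter 2 sch_U \<tau> = (E2 \<tau> * (1/72 * E4 \<tau>) + - 1/72 * E6 \<tau>) * eta_quotient \<tau>"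
proof -
  note [derivative_intros] = level3_E2_has_field_derivative[OF assms]
    Ramanujan_E4[OF assms] Ramanujan_E6[OF assms]
  have "serre_deriv_iter 2 sch_U \<tau> = serre_deriv 2 (serre_deriv_iter 1 sch_U) \<tau>"
    by (simp add: eval_nat_numeral)
  also have "\<dots> = ((E2 \<tau> ^ 2 - E4 \<tau>) / 12 * (1/8 * level3_E2 \<tau>) + E2 \<tau> * (1/8 * ((2 * level3_E2 \<tau>
      * E2 \<tau> - 3 * level3_E2 \<tau> ^ 2 + E4 \<tau>) / 12)) + 1/24 * ((E2 \<tau> * E4 \<tau> - E6 \<tau>) / 3)
      + (level3_E2 \<tau> / 4 - E2 \<tau> / 12 - of_nat 2 / 12 * E2 \<tau>) * (E2 \<tau> * (1/8 * level3_E2 \<tau>) + 1/24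
      * E4 \<tau>))
      * eta_quotient \<tau>"
    by (rule serre_deriv_quasimodular_eq[OF serre_deriv_iter_1 assms])
      (auto intro!: derivative_eq_intros simp: field_simps eval_nat_numeral)
  also have "\<dots> = (E2 \<tau> * (1/72 * E4 \<tau>) + - 1/72 * E6 \<tau>) * eta_quotient \<tau>"
    by (simp add: field_simps eval_nat_numeral)
  finally show ?thesis .
qed

lemma serre_deriv_iter_3:
  assumes "Im \<tau> > 0"
  shows "serre_deriv_iter 3 sch_U \<tau> = (E2 \<tau> * ((1/288 * level3_E2 \<tau> * E4 \<tau> - 5/864 * E6 \<tau>))
      + (5/864 * E4 \<tau> ^ 2 - 1/288 * level3_E2 \<tau> * E6 \<tau>)) * eta_quotient \<tau>"
proof -
  note [derivative_intros] = level3_E2_has_field_derivative[OF assms]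
    Ramanujan_E4[OF assms] Ramanujan_E6[OF assms]
  have "serre_deriv_iter 3 sch_U \<tau> = serre_deriv 4 (serre_deriv_iter 2 sch_U) \<tau>"
    by (simp add: eval_nat_numeral)
  also have "\<dots> = ((E2 \<tau> ^ 2 - E4 \<tau>) / 12 * (1/72 * E4 \<tau>) + E2 \<tau> * (1/72 * ((E2 \<tau> * E4 \<tau>
      - E6 \<tau>) / 3)) + - 1/72 * ((E2 \<tau> * E6 \<tau> - E4 \<tau> ^ 2) / 2)
      + (level3_E2 \<tau> / 4 - E2 \<tau> / 12 - of_nat 4 / 12 * E2 \<tau>) * (E2 \<tau> * (1/72 * E4 \<tau>) + - 1/72
      * E6 \<tau>))
      * eta_quotient \<tau>"
    by (rule serre_deriv_quasimodular_eq[OF serre_deriv_iter_2 assms])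
      (auto intro!: derivative_eq_intros simp: field_simps eval_nat_numeral)
  also have "\<dots> = (E2 \<tau> * ((1/288 * level3_E2 \<tau> * E4 \<tau> - 5/864 * E6 \<tau>)) + (5/864 * E4 \<tau> ^ 2 - 1/288
      * level3_E2 \<tau> * E6 \<tau>)) * eta_quotient \<tau>"
    by (simp add: field_simps eval_nat_numeral)
  finally show ?thesis .
qed

lemma serre_deriv_iter_4:
  assumes "Im \<tau> > 0"
  shows "serre_deriv_iter 4 sch_U \<tau> = (E2 \<tau> * ((19/5184 * E4 \<tau> ^ 2 - 5/1728 * level3_E2 \<tau> * E6 \<tau>))
      + (5/1728 * level3_E2 \<tau> * E4 \<tau> ^ 2 - 19/5184 * E4 \<tau> * E6 \<tau>)) * eta_quotient \<tau>"
proof -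
  note [derivative_intros] = level3_E2_has_field_derivative[OF assms]
    Ramanujan_E4[OF assms] Ramanujan_E6[OF assms]
  have "serre_deriv_iter 4 sch_U \<tau> = serre_deriv 6 (serre_deriv_iter 3 sch_U) \<tau>"
    by (simp add: eval_nat_numeral)
  also have "\<dots> = ((E2 \<tau> ^ 2 - E4 \<tau>) / 12 * ((1/288 * level3_E2 \<tau> * E4 \<tau> - 5/864 * E6 \<tau>)) + E2 \<tau>
      * ((1/288 * ((2 * level3_E2 \<tau> * E2 \<tau> - 3 * level3_E2 \<tau> ^ 2 + E4 \<tau>) / 12) * E4 \<tau> + 1/288
      * level3_E2 \<tau> * ((E2 \<tau> * E4 \<tau> - E6 \<tau>) / 3) - 5/864 * ((E2 \<tau> * E6 \<tau> - E4 \<tau> ^ 2) / 2)))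
      + (5/864 * (2 * E4 \<tau> * ((E2 \<tau> * E4 \<tau> - E6 \<tau>) / 3)) - (1/288 * ((2 * level3_E2 \<tau> * E2 \<tau> - 3
      * level3_E2 \<tau> ^ 2 + E4 \<tau>) / 12) * E6 \<tau> + 1/288 * level3_E2 \<tau> * ((E2 \<tau> * E6 \<tau>
      - E4 \<tau> ^ 2) / 2)))
      + (level3_E2 \<tau> / 4 - E2 \<tau> / 12 - of_nat 6 / 12 * E2 \<tau>) * (E2 \<tau> * ((1/288 * level3_E2 \<tau>
      * E4 \<tau> - 5/864 * E6 \<tau>)) + (5/864 * E4 \<tau> ^ 2 - 1/288 * level3_E2 \<tau> * E6 \<tau>)))
      * eta_quotient \<tau>"
    by (rule serre_deriv_quasimodular_eq[OF serre_deriv_iter_3 assms])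
      (auto intro!: derivative_eq_intros simp: field_simps eval_nat_numeral)
  also have "\<dots> = (E2 \<tau> * ((19/5184 * E4 \<tau> ^ 2 - 5/1728 * level3_E2 \<tau> * E6 \<tau>)) + (5/1728
      * level3_E2 \<tau> * E4 \<tau> ^ 2 - 19/5184 * E4 \<tau> * E6 \<tau>)) * eta_quotient \<tau>"
    by (simp add: field_simps eval_nat_numeral)
  finally show ?thesis .
qed

lemma serre_deriv_iter_5:
  assumes "Im \<tau> > 0"
  shows "serre_deriv_iter 5 sch_U \<tau> = (E2 \<tau> * ((1/384 * level3_E2 \<tau> * E4 \<tau> ^ 2 - 31/10368 * E4 \<tau>
      * E6 \<tau>)) + (55/31104 * E4 \<tau> ^ 3 + 19/15552 * E6 \<tau> ^ 2 - 1/384 * level3_E2 \<tau> * E4 \<tau> * E6 \<tau>))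
      * eta_quotient \<tau>"
proof -
  note [derivative_intros] = level3_E2_has_field_derivative[OF assms]
    Ramanujan_E4[OF assms] Ramanujan_E6[OF assms]
  have "serre_deriv_iter 5 sch_U \<tau> = serre_deriv 8 (serre_deriv_iter 4 sch_U) \<tau>"
    by (simp add: eval_nat_numeral)
  also have "\<dots> = ((E2 \<tau> ^ 2 - E4 \<tau>) / 12 * ((19/5184 * E4 \<tau> ^ 2 - 5/1728 * level3_E2 \<tau> * E6 \<tau>))
      + E2 \<tau> * ((19/5184 * (2 * E4 \<tau> * ((E2 \<tau> * E4 \<tau> - E6 \<tau>) / 3)) - (5/1728 * ((2 * level3_E2 \<tau>
      * E2 \<tau> - 3 * level3_E2 \<tau> ^ 2 + E4 \<tau>) / 12) * E6 \<tau> + 5/1728 * level3_E2 \<tau> * ((E2 \<tau> * E6 \<tau>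
      - E4 \<tau> ^ 2) / 2)))) + (5/1728 * ((2 * level3_E2 \<tau> * E2 \<tau> - 3 * level3_E2 \<tau> ^ 2 + E4 \<tau>) / 12)
      * E4 \<tau> ^ 2 + 5/1728 * level3_E2 \<tau> * (2 * E4 \<tau> * ((E2 \<tau> * E4 \<tau> - E6 \<tau>) / 3)) - (19/5184
      * ((E2 \<tau> * E4 \<tau> - E6 \<tau>) / 3) * E6 \<tau> + 19/5184 * E4 \<tau> * ((E2 \<tau> * E6 \<tau> - E4 \<tau> ^ 2) / 2)))
      + (level3_E2 \<tau> / 4 - E2 \<tau> / 12 - of_nat 8 / 12 * E2 \<tau>) * (E2 \<tau> * ((19/5184 * E4 \<tau> ^ 2
      - 5/1728 * level3_E2 \<tau> * E6 \<tau>)) + (5/1728 * level3_E2 \<tau> * E4 \<tau> ^ 2 - 19/5184 * E4 \<tau> * E6 \<tau>)))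
      * eta_quotient \<tau>"
    by (rule serre_deriv_quasimodular_eq[OF serre_deriv_iter_4 assms])
      (auto intro!: derivative_eq_intros simp: field_simps eval_nat_numeral)
  also have "\<dots> = (E2 \<tau> * ((1/384 * level3_E2 \<tau> * E4 \<tau> ^ 2 - 31/10368 * E4 \<tau> * E6 \<tau>)) + (55/31104
      * E4 \<tau> ^ 3 + 19/15552 * E6 \<tau> ^ 2 - 1/384 * level3_E2 \<tau> * E4 \<tau> * E6 \<tau>)) * eta_quotient \<tau>"
    by (simp add: field_simps eval_nat_numeral)
  finally show ?thesis .
qed

theorem proposition6p3:
  fixes \<tau> :: complex
  assumes "Im \<tau> > 0"
  shows "serre_deriv_iter 5 sch_U \<tau>
       - 7 / 36 * E4 \<tau> * serre_deriv_iter 3 sch_U \<tau>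
       + 19 / 216 * E6 \<tau> * serre_deriv_iter 2 sch_U \<tau>
       - 5 / 324 * E4 \<tau> ^ 2 * serre_deriv_iter 1 sch_U \<tau>
       + 5 / 1944 * E4 \<tau> * E6 \<tau> * sch_U \<tau> = 0"
  \<comment> \<open>After division by the eta quotient, the coefficient of E2 and the remaining part
    each vanish as polynomials in M, E4 and E6, with no further relation between these
    functions.\<close>
  unfolding serre_deriv_iter_5[OF assms] serre_deriv_iter_3[OF assms] serre_deriv_iter_2[OF assms]
    serre_deriv_iter_1[OF assms] sch_U_eq
  by (simp add: field_simps eval_nat_numeral)

end
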